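(* For all parameter values $H\in(0,1)$, $\alpha\in(0,1)$, $b\in\{2,3,\dots\}$, the sample paths of $Y$ admit $\mathbb P$-almost surely the roughness exponent $H\wedge K=\min\{H,K\}$.
   Context: Let $(\Omega,\mathcal F,\mathbb P)$ be a probability space, $H\in(0,1)$, and let $W_H=\{W_H(t):0\le t\le 1\}$ be a continuous fractional Brownian motion with Hurst parameter $H$, i.e. a continuous centered Gaussian process with $\mathbb E[W_H(s)W_H(t)]=\frac12(s^{2H}+t^{2H}-|t-s|^{2H})$. Let $\kappa:[0,1]\to[0,1]$ be a deterministic function with $\kappa(0)=0$, $\kappa(1)=1$, Hölder continuous with some exponent $\tau\in(H,1]$, and put $B_H(u):=W_H(u)-\kappa(u)W_H(1)$, $0\le u\le1$. Let $\alpha\in(0,1)$ and $b\in\{2,3,\dots\}$. The fractional Wiener--Weierstrass bridge with parameters $\alpha,b,H$ is $$Y(t):=\sum_{n=0}^\infty\alpha^nB_H(\{b^nt\}),\qquad 0\le t\le1,$$ where $\{x\}$ denotes the fractional part of $x\ge0$. Put $K:=\min\{1,-\log_b\alpha\}$. For a continuous function $f:[0,1]\to\mathbb R$ and $q>0$, write $V_n^{(q)}(f,t):=\sum_{k=0}^{\lfloor tb^n\rfloor-1}|f((k+1)b^{-n})-f(kb^{-n})|^q$, $0\le t\le 1$. A continuous function $f:[0,1]\to\mathbb R$ admits the roughness exponent $R\in[0,1]$ if, as $n\to\infty$, $V_n^{(q)}(f,1)\to+\infty$ for $q<1/R$ and $V_n^{(q)}(f,1)\to0$ for $q>1/R$.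 *)

theory Defs
  imports "HOL-Probability.Probability"
begin

(* A standard deviation of zero is allowed: constants count as Gaussian. *)
definition gaussian_rv :: "'a measure \<Rightarrow> ('a \<Rightarrow> real) \<Rightarrow> bool" where
  "gaussian_rv M X \<longleftrightarrow> X \<in> borel_measurable M \<and>
     ((\<exists>m. AE \<omega> in M. X \<omega> = m) \<or>
      (\<exists>m \<sigma>. \<sigma> > 0 \<and> distributed M lborel X (\<lambda>x. ennreal (normal_density m \<sigma> x))))"

definition gaussian_process :: "'a measure \<Rightarrow> 't set \<Rightarrow> ('t \<Rightarrow> 'a \<Rightarrow> real) \<Rightarrow> bool" where
  "gaussian_process M T X \<longleftrightarrow>
     (\<forall>F c. finite F \<and> F \<subseteq> T \<longrightarrow> gaussian_rv M (\<lambda>\<omega>. \<Sum>t\<in>F. c t * X t \<omega>))"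

(* Continuity of the paths is only required almost surely, which includes the case of processes
   all of whose paths are continuous. *)
definition fractional_brownian_motion ::
  "'a measure \<Rightarrow> real \<Rightarrow> (real \<Rightarrow> 'a \<Rightarrow> real) \<Rightarrow> bool" where
  "fractional_brownian_motion M H W \<longleftrightarrow>
     gaussian_process M {0..1} W \<and>
     (\<forall>t\<in>{0..1}. integral\<^sup>L M (W t) = 0) \<and>
     (\<forall>s\<in>{0..1}. \<forall>t\<in>{0..1}. integral\<^sup>L M (\<lambda>\<omega>. W s \<omega> * W t \<omega>) =
        (s powr (2 * H) + t powr (2 * H) - \<bar>t - s\<bar> powr (2 * H)) / 2) \<and>
     (AE \<omega> in M. continuous_on {0..1} (\<lambda>t. W t \<omega>))"

definition hoelder_continuous_on :: "real set \<Rightarrow> real \<Rightarrow> (real \<Rightarrow> real) \<Rightarrow> bool" where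
  "hoelder_continuous_on S \<tau> f \<longleftrightarrow>
     (\<exists>C. \<forall>s\<in>S. \<forall>t\<in>S. \<bar>f s - f t\<bar> \<le> C * \<bar>s - t\<bar> powr \<tau>)"

definition fractional_bridge ::
  "(real \<Rightarrow> real) \<Rightarrow> (real \<Rightarrow> 'a \<Rightarrow> real) \<Rightarrow> real \<Rightarrow> 'a \<Rightarrow> real" where
  "fractional_bridge \<kappa> W u \<omega> = W u \<omega> - \<kappa> u * W 1 \<omega>"

definition wiener_weierstrass_bridge ::
  "real \<Rightarrow> nat \<Rightarrow> (real \<Rightarrow> real) \<Rightarrow> (real \<Rightarrow> 'a \<Rightarrow> real) \<Rightarrow> real \<Rightarrow> 'a \<Rightarrow> real" where
  "wiener_weierstrass_bridge \<alpha> b \<kappa> W t \<omega> =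
     (\<Sum>n. \<alpha> ^ n * fractional_bridge \<kappa> W (frac (real b ^ n * t)) \<omega>)"

definition power_variation ::
  "nat \<Rightarrow> real \<Rightarrow> nat \<Rightarrow> (real \<Rightarrow> real) \<Rightarrow> real \<Rightarrow> real" where
  "power_variation b q n f t =
     (\<Sum>k<nat \<lfloor>t * real b ^ n\<rfloor>. \<bar>f ((real k + 1) / real b ^ n) - f (real k / real b ^ n)\<bar> powr q)"

(* The reciprocal is taken in the extended reals, so that 1/R is infinite for R = 0. *)
definition admits_roughness_exponent :: "nat \<Rightarrow> (real \<Rightarrow> real) \<Rightarrow> real \<Rightarrow> bool" where
  "admits_roughness_exponent b f R \<longleftrightarrow>
     continuous_on {0..1} f \<and> R \<in> {0..1} \<and>
     (\<forall>q>0. ereal q < 1 / ereal R \<longrightarrow>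
        filterlim (\<lambda>n. power_variation b q n f 1) at_top sequentially) \<and>
     (\<forall>q>0. ereal q > 1 / ereal R \<longrightarrow>
        (\<lambda>n. power_variation b q n f 1) \<longlonglongrightarrow> 0)"

end

(* Let beta = b, let dB_m(j) be the increment of B_H over the j-th b-adic cell of level m, and let D_n(k)
   be the corresponding increment of Y. Since B_H(0) = B_H(1) = 0,
   D_n(k) = sum_{m=1..n} alpha^(n-m) dB_m(k mod b^m).
   Vanishing of the variation for large q: by Gaussian tails and Borel-Cantelli, almost surely
   |dB_m(j)| <= C (m+1) b^(-Hm), hence |D_n(k)| <= C (n+1)^2 b^(-n R) with R = min(H, K).
   Divergence for small q: D_n(p + b^r) - D_n(p) only involves the levels m > r. Its variance is
   bounded below by testing it against the single increment of W_H at level r+1 that contains the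
   changed digit r: all other increments are either far away from it, and then almost uncorrelated with
   it, or too small. By Gaussian anticoncentration, each difference exceeds its standard deviation
   divided by (n+1)^2 up to probability (n+1)^(-2), so that by Markov and Borel-Cantelli at least
   half of the differences do so for all large n. The choice r = n-1 yields divergence
   for q < 1/H, and if K < H a fixed large r yields divergence for q < 1/K. *)
theory Submission
  imports Defs "HOL-Real_Asymp.Real_Asymp"
begin

section \<open>Gaussian random variables\<close>

text \<open>The obstacle is the coarse levels: there the correction by \<open>\<kappa>\<close> and
  the long-range correlations of W can be of the same order as the increments themselves; relative
  to them they become small only at fine levels (\<open>\<rho>\<close> tends to 0). Passing to D_n(p
  + b^r) - D_n(p) removes the levels up to r exactly. To decorrelate the test increment from the
  rest, p is taken with digits r, ..., r + L equal to 0. At level r + 1 + l with l \<le> L the two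
  cells then have the indices p mod b^r and p mod b^r + b^r, which do not depend on l, so these
  cells move towards 0 as l grows, while the test cell starts at 1/b or later. Such p still make up
  a fraction b^(-L-1) of all indices. Level r + 1 + l has relative weight \<xi>^l with \<xi> =
  b^(-H) / \<alpha>, which is summable exactly if K < H. With r = n - 1 a single level survives, and
  no condition on \<xi> arises; the borderline case H = K is settled this way. The sequence
  (n+1)^(-2) is summable, yet costs only a polynomial factor against an exponential one.\<close>

lemma (in prob_space) gaussian_rv_cases:
  assumes "gaussian_rv M X" and mean: "expectation X = 0"
  obtains (null) "AE \<omega> in M. X \<omega> = 0" "expectation (\<lambda>\<omega>. (X \<omega>)\<^sup>2) = 0"
  | (normal) \<sigma> where "\<sigma> > 0" "distributed M lborel X (normal_density 0 \<sigma>)"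
      "expectation (\<lambda>\<omega>. (X \<omega>)\<^sup>2) = \<sigma>\<^sup>2"
proof -
  have X[measurable]: "X \<in> borel_measurable M"
    using assms by (simp add: gaussian_rv_def)
  from assms(1) consider m where "AE \<omega> in M. X \<omega> = m"
    | m \<sigma> where "\<sigma> > 0" "distributed M lborel X (\<lambda>x. ennreal (normal_density m \<sigma> x))"
    unfolding gaussian_rv_def by blast
  then show thesis
  proof cases
    case (1 m)
    have "expectation X = expectation (\<lambda>_. m)"
      by (rule integral_cong_AE) (use 1 in auto)
    then have "m = 0" using mean by (simp add: prob_space)
    with 1 have ae: "AE \<omega> in M. X \<omega> = 0" by simp
    have "expectation (\<lambda>\<omega>. (X \<omega>)\<^sup>2) = expectation (\<lambda>_. 0)"
      by (rule integral_cong_AE) (use ae in auto)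
    with ae show thesis by (intro null) auto
  next
    case (2 m \<sigma>)
    have "m = 0"
      using normal_distributed_expectation[OF 2] mean by simp
    moreover have "variance X = \<sigma>\<^sup>2"
      by (rule normal_distributed_variance[OF 2])
    ultimately show thesis
      using 2 mean by (intro normal) auto
  qed
qed

lemma (in prob_space) gaussian_rv_square_integrable:
  assumes "gaussian_rv M X"
  shows "integrable M (\<lambda>\<omega>. (X \<omega>)\<^sup>2)"
proof -
  have X[measurable]: "X \<in> borel_measurable M"
    using assms by (simp add: gaussian_rv_def)
  from assms(1) consider m where "AE \<omega> in M. X \<omega> = m"
    | m \<sigma> where "\<sigma> > 0" "distributed M lborel X (\<lambda>x. ennreal (normal_density m \<sigma> x))"
    unfolding gaussian_rv_def by blast
  then show ?thesis
  proof cases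
    case (1 m)
    have "integrable M (\<lambda>_. m\<^sup>2)" by simp
    then show ?thesis
      by (rule integrable_cong_AE_imp) (use 1 in auto)
  next
    case (2 m \<sigma>)
    \<comment> \<open>The second moment about 0 is assembled from the centered one: x^2 = (x - m)^2
      + 2mx - m^2.\<close>
    have "integrable lborel (\<lambda>x. normal_density m \<sigma> x * (x - m)\<^sup>2 +
        (2 * m) * (normal_density m \<sigma> x * x) - m\<^sup>2 * normal_density m \<sigma> x)"
      using 2 by (intro Bochner_Integration.integrable_add Bochner_Integration.integrable_diff
          integrable_mult_right integrable_normal_moment integrable_normal_moment_nz_1) auto
    also have "(\<lambda>x. normal_density m \<sigma> x * (x - m)\<^sup>2 +
        (2 * m) * (normal_density m \<sigma> x * x) - m\<^sup>2 * normal_density m \<sigma> x) =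
        (\<lambda>x. normal_density m \<sigma> x * x\<^sup>2)"
      by (auto simp: fun_eq_iff power2_eq_square algebra_simps)
    finally show ?thesis
      using distributed_integrable[OF 2(2), of "\<lambda>x. x\<^sup>2"] by simp
  qed
qed

text \<open>The maximum 1 / (sqrt (2 pi) \<sigma>) is rounded up by 2 pi \<ge> 4, which makes the
  constant of the small ball estimate equal to 1.\<close>

lemma normal_density_le:
  assumes "\<sigma> > 0"
  shows "normal_density \<mu> \<sigma> x \<le> 1 / (2 * \<sigma>)"
proof -
  have "2 * \<sigma> = sqrt (2\<^sup>2 * \<sigma>\<^sup>2)"
    using assms by (simp add: real_sqrt_mult)
  also have "\<dots> \<le> sqrt (2 * pi * \<sigma>\<^sup>2)"
    using pi_gt3 by (intro real_sqrt_le_mono mult_right_mono) auto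
  finally have le: "2 * \<sigma> \<le> sqrt (2 * pi * \<sigma>\<^sup>2)" .
  have "normal_density \<mu> \<sigma> x \<le> 1 / sqrt (2 * pi * \<sigma>\<^sup>2)"
    unfolding normal_density_def
    by (rule mult_left_le) (auto simp: divide_nonpos_nonneg)
  also have "\<dots> \<le> 1 / (2 * \<sigma>)"
    using assms le by (intro divide_left_mono) auto
  finally show ?thesis .
qed

text \<open>Anticoncentration: an interval of length 2 \<delta> s meets a density of at most 1 / (2
  \<sigma>), and s \<le> \<sigma>. Only a lower bound for the variance enters, so one \<delta>
  serves all cells of a level.\<close>

lemma (in prob_space) gaussian_small_ball:
  assumes "gaussian_rv M X" "expectation X = 0"
    and s: "0 < s" "s\<^sup>2 \<le> expectation (\<lambda>\<omega>. (X \<omega>)\<^sup>2)" and \<delta>: "0 \<le> \<delta>"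
  shows "prob {\<omega> \<in> space M. \<bar>X \<omega>\<bar> < \<delta> * s} \<le> \<delta>"
  using assms(1,2)
proof (cases rule: gaussian_rv_cases)
  case null
  then show ?thesis using s by simp
next
  case (normal \<sigma>)
  have "s \<le> \<sigma>"
    by (rule power2_le_imp_le) (use s normal in auto)
  have "emeasure M {\<omega> \<in> space M. \<bar>X \<omega>\<bar> < \<delta> * s} = emeasure M (X -` {-\<delta> * s<..<\<delta> * s} \<inter> space M)"
    by (rule arg_cong[where f="emeasure M"]) auto
  also have "\<dots> = (\<integral>\<^sup>+x. ennreal (normal_density 0 \<sigma> x) * indicator {-\<delta> * s<..<\<delta> * s} x \<partial>lborel)"
    by (rule distributed_emeasure[OF normal(2)]) auto
  also have "\<dots> \<le> (\<integral>\<^sup>+x. ennreal (1 / (2 * \<sigma>)) * indicator {-\<delta> * s<..<\<delta> * s} x \<partial>lborel)"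
    using normal(1) by (intro nn_integral_mono mult_right_mono ennreal_leI normal_density_le) auto
  also have "\<dots> = ennreal (1 / (2 * \<sigma>)) * ennreal (\<delta> * s + \<delta> * s)"
    using s \<delta> by (subst nn_integral_cmult_indicator) auto
  also have "\<dots> = ennreal (1 / (2 * \<sigma>) * (\<delta> * s + \<delta> * s))"
    using normal(1) s \<delta> by (intro ennreal_mult[symmetric]) auto
  also have "1 / (2 * \<sigma>) * (\<delta> * s + \<delta> * s) = \<delta> * (s / \<sigma>)"
    using normal(1) by (simp add: field_simps)
  also have "ennreal (\<delta> * (s / \<sigma>)) \<le> ennreal \<delta>"
    using \<open>s \<le> \<sigma>\<close> normal(1) s \<delta> by (intro ennreal_leI mult_left_le) auto
  finally show ?thesis
    using \<delta> by (simp add: emeasure_eq_measure)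
qed

(* Chernoff bound with parameter 1: completing the square turns
   exp (x - u) times the standard density into a shifted standard density. *)
lemma (in prob_space) gaussian_tail:
  assumes "gaussian_rv M X" "expectation X = 0"
    and s: "0 < s" "expectation (\<lambda>\<omega>. (X \<omega>)\<^sup>2) = s\<^sup>2"
  shows "prob {\<omega> \<in> space M. u * s < \<bar>X \<omega>\<bar>} \<le> 2 * exp (1 / 2 - u)"
  using assms(1,2)
proof (cases rule: gaussian_rv_cases)
  case null
  then show ?thesis using s by simp
next
  case (normal \<sigma>)
  have "s = \<sigma>"
    using s normal by (simp add: power2_eq_iff_nonneg)
  then have D: "distributed M lborel (\<lambda>\<omega>. X \<omega> / s) std_normal_density"
    using normal normal_standard_normal_convert[of s X 0] by simp
  let ?A = "{..<-u} \<union> {u<..}"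
  have pw: "std_normal_density x * indicator ?A x
      \<le> exp (1 / 2 - u) * (normal_density 1 1 x + normal_density (-1) 1 x)" for x
  proof (cases "x \<in> ?A")
    case True
    have e: "exp (1/2 - u) * exp (- (x - 1)\<^sup>2 / 2) = exp (- x\<^sup>2 / 2) * exp (x - u)"
        "exp (1/2 - u) * exp (- (x + 1)\<^sup>2 / 2) = exp (- x\<^sup>2 / 2) * exp (- x - u)"
      unfolding exp_add[symmetric] by (simp_all add: power2_eq_square field_simps)
    have "1 \<le> exp (x - u) + exp (- x - u)"
    proof (cases "x > u")
      case True
      then show ?thesis by (smt (verit) exp_gt_zero one_le_exp_iff)
    next
      case False
      with \<open>x \<in> ?A\<close> have "- x - u \<ge> 0" by auto
      then show ?thesis by (smt (verit) exp_gt_zero one_le_exp_iff)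
    qed
    then have "exp (- x\<^sup>2 / 2) * 1 \<le> exp (- x\<^sup>2 / 2) * (exp (x - u) + exp (- x - u))"
      by (intro mult_left_mono) auto
    also have "\<dots> = exp (1/2 - u) * exp (- (x - 1)\<^sup>2 / 2) + exp (1/2 - u) * exp (- (x + 1)\<^sup>2 / 2)"
      unfolding e by (simp add: algebra_simps)
    finally have "1 / sqrt (2 * pi) * exp (- x\<^sup>2 / 2) \<le> 1 / sqrt (2 * pi) *
       (exp (1/2 - u) * exp (- (x - 1)\<^sup>2 / 2) + exp (1/2 - u) * exp (- (x + 1)\<^sup>2 / 2))"
      by (intro mult_left_mono) auto
    then show ?thesis
      using True unfolding normal_density_def by (simp add: field_simps)
  qed auto
  have "emeasure M {\<omega> \<in> space M. u * s < \<bar>X \<omega>\<bar>} = emeasure M ((\<lambda>\<omega>. X \<omega> / s) -` ?A \<inter> space M)"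
    by (rule arg_cong[where f="emeasure M"]) (use s in \<open>auto simp: field_simps\<close>)
  also have "\<dots> = (\<integral>\<^sup>+x. ennreal (std_normal_density x) * indicator ?A x \<partial>lborel)"
    by (rule distributed_emeasure[OF D]) auto
  also have "\<dots> = (\<integral>\<^sup>+x. ennreal (std_normal_density x * indicator ?A x) \<partial>lborel)"
    by (intro nn_integral_cong) (auto split: split_indicator)
  also have "\<dots> \<le> (\<integral>\<^sup>+x. ennreal (exp (1 / 2 - u) *
      (normal_density 1 1 x + normal_density (-1) 1 x)) \<partial>lborel)"
    by (intro nn_integral_mono ennreal_leI pw)
  also have "\<dots> = ennreal (\<integral>x. exp (1 / 2 - u) *
      (normal_density 1 1 x + normal_density (-1) 1 x) \<partial>lborel)"
    by (rule nn_integral_eq_integral) auto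
  also have "(\<integral>x. exp (1 / 2 - u) * (normal_density 1 1 x + normal_density (-1) 1 x) \<partial>lborel)
      = 2 * exp (1 / 2 - u)"
    by (simp add: Bochner_Integration.integral_add)
  finally show ?thesis
    by (simp add: emeasure_eq_measure)
qed

(* Markov's inequality for the number of small values, followed by Borel-Cantelli;
   no independence of the X n i is involved. *)
lemma (in prob_space) AE_eventually_few_small:
  fixes X :: "nat \<Rightarrow> 'i \<Rightarrow> 'a \<Rightarrow> real"
  assumes fin: "\<And>n. finite (I n)" and ne: "\<And>n. I n \<noteq> {}"
    and meas: "\<And>n i. i \<in> I n \<Longrightarrow> X n i \<in> borel_measurable M"
    and small: "eventually (\<lambda>n. \<forall>i\<in>I n. prob {\<omega> \<in> space M. \<bar>X n i \<omega>\<bar> < \<epsilon> n} \<le> \<delta> n) sequentially"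
    and sum: "summable \<delta>"
  shows "AE \<omega> in M. eventually (\<lambda>n. real (card (I n)) / 2 \<le>
    real (card {i \<in> I n. \<epsilon> n \<le> \<bar>X n i \<omega>\<bar>})) sequentially"
proof -
  define B where "B n i = {\<omega> \<in> space M. \<bar>X n i \<omega>\<bar> < \<epsilon> n}" for n i
  define N where "N n \<omega> = (\<Sum>i\<in>I n. indicator (B n i) \<omega> :: real)" for n \<omega>
  define A where "A n = {\<omega> \<in> space M. real (card (I n)) / 2 \<le> N n \<omega>}" for n
  have B[measurable]: "B n i \<in> sets M" if "i \<in> I n" for n i
    unfolding B_def using meas[OF that] by measurable
  have N[measurable]: "N n \<in> borel_measurable M" for n
    unfolding N_def by (rule borel_measurable_sum) (auto simp: B)
  have A[measurable]: "A n \<in> sets M" for n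
    unfolding A_def by measurable
  have cpos: "0 < real (card (I n))" for n
    using fin ne by (simp add: card_gt_0_iff)
  have "prob (A n) \<le> 2 * \<delta> n" if "\<forall>i\<in>I n. prob (B n i) \<le> \<delta> n" for n
  proof -
    have int: "integrable M (N n)"
      unfolding N_def by (intro Bochner_Integration.integrable_sum)
        (auto simp: B emeasure_eq_measure)
    have "expectation (N n) = (\<Sum>i\<in>I n. prob (B n i))"
      unfolding N_def by (subst Bochner_Integration.integral_sum) (auto simp: B emeasure_eq_measure)
    also have "\<dots> \<le> (\<Sum>i\<in>I n. \<delta> n)"
      using that by (intro sum_mono) auto
    finally have e: "expectation (N n) \<le> real (card (I n)) * \<delta> n" by simp
    have "prob (A n) \<le> expectation (N n) / (real (card (I n)) / 2)"
      unfolding A_def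
    proof (rule integral_Markov_inequality_measure[where A="space M"])
      show "AE \<omega> in M. 0 \<le> N n \<omega>"
        by (simp add: N_def sum_nonneg)
    qed (use cpos[of n] int in auto)
    also have "\<dots> \<le> real (card (I n)) * \<delta> n / (real (card (I n)) / 2)"
      using e cpos[of n] by (intro divide_right_mono) auto
    also have "\<dots> = 2 * \<delta> n" using cpos[of n] by simp
    finally show ?thesis .
  qed
  then have "eventually (\<lambda>n. norm (prob (A n)) \<le> 2 * \<delta> n) sequentially"
    using small unfolding B_def by (auto elim!: eventually_mono)
  then have "summable (\<lambda>n. prob (A n))"
    by (rule summable_comparison_test_ev) (intro summable_mult sum)
  then have "AE \<omega> in M. eventually (\<lambda>n. \<omega> \<in> space M - A n) sequentially"
    by (intro borel_cantelli_AE1) (auto simp: emeasure_eq_measure)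
  then show ?thesis
  proof eventually_elim
    case (elim \<omega>)
    then show ?case
    proof eventually_elim
      case (elim n)
      have "N n \<omega> = real (card {i \<in> I n. \<bar>X n i \<omega>\<bar> < \<epsilon> n})"
        unfolding N_def indicator_def using elim fin[of n]
        by (simp add: B_def sum.If_cases Int_def)
      moreover have "card (I n) = card {i \<in> I n. \<bar>X n i \<omega>\<bar> < \<epsilon> n} + card {i \<in> I n. \<epsilon> n \<le> \<bar>X n i \<omega>\<bar>}"
        using fin[of n] by (subst card_Un_disjoint[symmetric]) (auto intro!: arg_cong[where f=card])
      ultimately show ?case
        using elim by (auto simp: A_def)
    qed
  qed
qed

section \<open>Covariances of fractional Brownian motion\<close>

text \<open>\<open>gaussian_process\<close> speaks of sums over a set of distinct times. With
  closure rules instead, increments, bridge increments and their weighted sums become Gaussian by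
  structural reasoning, and \<open>lin_span_representation\<close> restores the normal form
  once.\<close>

inductive_set lin_span :: "('t \<Rightarrow> 'a \<Rightarrow> real) \<Rightarrow> 't set \<Rightarrow> ('a \<Rightarrow> real) set"
  for X :: "'t \<Rightarrow> 'a \<Rightarrow> real" and T :: "'t set" where
  zero: "(\<lambda>_. 0) \<in> lin_span X T"
| base: "t \<in> T \<Longrightarrow> X t \<in> lin_span X T"
| add: "f \<in> lin_span X T \<Longrightarrow> g \<in> lin_span X T \<Longrightarrow> (\<lambda>\<omega>. f \<omega> + g \<omega>) \<in> lin_span X T"
| scale: "f \<in> lin_span X T \<Longrightarrow> (\<lambda>\<omega>. c * f \<omega>) \<in> lin_span X T"

lemma lin_span_diff:
  assumes "f \<in> lin_span X T" "g \<in> lin_span X T"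
  shows "(\<lambda>\<omega>. f \<omega> - g \<omega>) \<in> lin_span X T"
  using lin_span.add[OF assms(1) lin_span.scale[OF assms(2), of "-1"]] by simp

lemma lin_span_sum:
  assumes "\<And>i. i \<in> I \<Longrightarrow> f i \<in> lin_span X T"
  shows "(\<lambda>\<omega>. \<Sum>i\<in>I. f i \<omega>) \<in> lin_span X T"
  using assms
proof (induction I rule: infinite_finite_induct)
  case (insert i I)
  then have "(\<lambda>\<omega>. f i \<omega> + (\<Sum>i\<in>I. f i \<omega>)) \<in> lin_span X T"
    by (intro lin_span.add) auto
  with insert show ?case by simp
qed (auto intro: lin_span.zero)

lemma lin_span_representation:
  assumes "f \<in> lin_span X T"
  shows "\<exists>F c. finite F \<and> F \<subseteq> T \<and> f = (\<lambda>\<omega>. \<Sum>t\<in>F. c t * X t \<omega>)"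
  using assms
proof induction
  case zero
  then show ?case by (intro exI[of _ "{}"]) auto
next
  case (base t)
  then show ?case by (intro exI[of _ "{t}"] exI[of _ "\<lambda>_. 1"]) auto
next
  case (add f g)
  then obtain F c G d where F: "finite F" "F \<subseteq> T" "f = (\<lambda>\<omega>. \<Sum>t\<in>F. c t * X t \<omega>)"
    and G: "finite G" "G \<subseteq> T" "g = (\<lambda>\<omega>. \<Sum>t\<in>G. d t * X t \<omega>)" by blast
  \<comment> \<open>A time common to F and G may occur only once in the normal form, so both
    coefficient functions are extended by 0 and added.\<close>
  define e where "e t = (if t \<in> F then c t else 0) + (if t \<in> G then d t else 0)" for t
  have "(\<Sum>t\<in>F. c t * X t \<omega>) = (\<Sum>t\<in>F \<union> G. (if t \<in> F then c t else 0) * X t \<omega>)" for \<omega>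
    using F G by (intro sum.mono_neutral_cong_left) auto
  moreover have "(\<Sum>t\<in>G. d t * X t \<omega>) = (\<Sum>t\<in>F \<union> G. (if t \<in> G then d t else 0) * X t \<omega>)" for \<omega>
    using F G by (intro sum.mono_neutral_cong_left) auto
  ultimately have "(\<lambda>\<omega>. f \<omega> + g \<omega>) = (\<lambda>\<omega>. \<Sum>t\<in>F \<union> G. e t * X t \<omega>)"
    unfolding F(3) G(3) e_def by (simp add: distrib_right sum.distrib)
  then show ?case
    using F G by (intro exI[of _ "F \<union> G"] exI[of _ e]) auto
next
  case (scale f c)
  then obtain F d where F: "finite F" "F \<subseteq> T" "f = (\<lambda>\<omega>. \<Sum>t\<in>F. d t * X t \<omega>)"
    by blast
  then show ?case
    by (intro exI[of _ F] exI[of _ "\<lambda>t. c * d t"]) (auto simp: sum_distrib_left mult.assoc)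
qed

text \<open>Two applications of the mean value theorem turn the mixed difference into p (p - 1) w^(p
  - 2) h k with some w > u, and x^(p - 2) is nonincreasing for p \<le> 2.\<close>

lemma second_difference_powr_bound:
  fixes u h k p :: real
  assumes "u > 0" "h \<ge> 0" "k \<ge> 0" "p \<le> 2"
  shows "\<bar>(u + h + k) powr p - (u + h) powr p - (u + k) powr p + u powr p\<bar>
    \<le> \<bar>p * (p - 1)\<bar> * u powr (p - 2) * h * k"
proof (cases "h = 0 \<or> k = 0")
  case True
  then show ?thesis by auto
next
  case False
  with assms have hk: "h > 0" "k > 0" by auto
  let ?g = "\<lambda>x. (x + k) powr p - x powr p"
  have "\<exists>z. u < z \<and> z < u + h \<and> ?g (u + h) - ?g u =
      (u + h - u) * (p * (z + k) powr (p - 1) - p * z powr (p - 1))"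
  proof (rule MVT2)
    fix x assume "u \<le> x" "x \<le> u + h"
    then have "x > 0" "x + k > 0" using assms by auto
    then show "DERIV ?g x :> p * (x + k) powr (p - 1) - p * x powr (p - 1)"
      by (auto intro!: derivative_eq_intros simp: powr_diff)
  qed (use hk in auto)
  then obtain z where z: "u < z" and gz: "?g (u + h) - ?g u =
      h * (p * (z + k) powr (p - 1) - p * z powr (p - 1))" by auto
  have "\<exists>w. z < w \<and> w < z + k \<and> (z + k) powr (p - 1) - z powr (p - 1) =
      (z + k - z) * ((p - 1) * w powr (p - 2))"
  proof (rule MVT2)
    fix x assume "z \<le> x" "x \<le> z + k"
    then have "x > 0" using assms z by auto
    have e: "p - 1 - 1 = p - 2" by simp
    have "DERIV (\<lambda>x. x powr (p - 1)) x :> (p - 1) * x powr (p - 1 - 1)"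
      using \<open>x > 0\<close> by (rule has_real_derivative_powr)
    then show "DERIV (\<lambda>x. x powr (p - 1)) x :> (p - 1) * x powr (p - 2)"
      unfolding e .
  qed (use hk in auto)
  then obtain w where w: "z < w" and gw: "(z + k) powr (p - 1) - z powr (p - 1) =
      k * ((p - 1) * w powr (p - 2))" by auto
  have "(u + h + k) powr p - (u + h) powr p - (u + k) powr p + u powr p = ?g (u + h) - ?g u"
    by simp
  also have "\<dots> = h * (p * ((z + k) powr (p - 1) - z powr (p - 1)))"
    unfolding gz by (simp add: right_diff_distrib)
  also have "\<dots> = (p * (p - 1)) * w powr (p - 2) * h * k"
    unfolding gw by simp
  also have "\<bar>\<dots>\<bar> = \<bar>p * (p - 1)\<bar> * w powr (p - 2) * h * k"
    using hk by (simp add: abs_mult)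
  also have "\<dots> \<le> \<bar>p * (p - 1)\<bar> * u powr (p - 2) * h * k"
    using hk z w assms by (intro mult_right_mono mult_left_mono powr_mono2') auto
  finally show ?thesis .
qed

locale fbm = prob_space M for M :: "'a measure" +
  fixes H :: real and W :: "real \<Rightarrow> 'a \<Rightarrow> real"
  assumes fbm: "fractional_brownian_motion M H W"
    and H_pos: "0 < H" and H_less_1: "H < 1"
begin

section \<open>The pre-Hilbert space spanned by W\<close>

abbreviation "V \<equiv> lin_span W {0..1}"

definition ip :: "('a \<Rightarrow> real) \<Rightarrow> ('a \<Rightarrow> real) \<Rightarrow> real" where
  "ip f g = expectation (\<lambda>\<omega>. f \<omega> * g \<omega>)"

lemma gaussian: "f \<in> V \<Longrightarrow> gaussian_rv M f"
  using lin_span_representation[of f W "{0..1}"] fbm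
  unfolding fractional_brownian_motion_def gaussian_process_def by blast

lemma measurable_V[measurable_dest]: "f \<in> V \<Longrightarrow> f \<in> borel_measurable M"
  using gaussian[of f] by (simp add: gaussian_rv_def)

lemma integrable_mult_V:
  assumes f: "f \<in> V" and g: "g \<in> V"
  shows "integrable M (\<lambda>\<omega>. f \<omega> * g \<omega>)"
proof (rule Bochner_Integration.integrable_bound)
  show "integrable M (\<lambda>\<omega>. (f \<omega>)\<^sup>2 + (g \<omega>)\<^sup>2)"
    using f g by (intro Bochner_Integration.integrable_add gaussian_rv_square_integrable gaussian)
  show "(\<lambda>\<omega>. f \<omega> * g \<omega>) \<in> borel_measurable M"
    using measurable_V[OF f] measurable_V[OF g] by measurable
  show "AE \<omega> in M. norm (f \<omega> * g \<omega>) \<le> norm ((f \<omega>)\<^sup>2 + (g \<omega>)\<^sup>2)"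
  proof (intro AE_I2)
    fix \<omega>
    have "2 * (\<bar>f \<omega>\<bar> * \<bar>g \<omega>\<bar>) \<le> (f \<omega>)\<^sup>2 + (g \<omega>)\<^sup>2"
      using sum_squares_bound[of "\<bar>f \<omega>\<bar>" "\<bar>g \<omega>\<bar>"] by simp
    moreover have "0 \<le> \<bar>f \<omega>\<bar> * \<bar>g \<omega>\<bar>" by simp
    ultimately have "\<bar>f \<omega>\<bar> * \<bar>g \<omega>\<bar> \<le> (f \<omega>)\<^sup>2 + (g \<omega>)\<^sup>2" by linarith
    then show "norm (f \<omega> * g \<omega>) \<le> norm ((f \<omega>)\<^sup>2 + (g \<omega>)\<^sup>2)"
      by (simp add: abs_mult)
  qed
qed

lemma integrable_V:
  assumes "f \<in> V" shows "integrable M f"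
  by (rule square_integrable_imp_integrable)
     (use measurable_V[OF assms] gaussian_rv_square_integrable[OF gaussian[OF assms]] in auto)

lemma mean_V: "f \<in> V \<Longrightarrow> expectation f = 0"
proof (induction rule: lin_span.induct)
  case (base t)
  then show ?case using fbm by (auto simp: fractional_brownian_motion_def)
qed (simp_all add: integrable_V)

lemma ip_commute: "ip f g = ip g f"
  unfolding ip_def by (simp add: mult.commute)

lemma ip_self: "ip f f = expectation (\<lambda>\<omega>. (f \<omega>)\<^sup>2)"
  unfolding ip_def by (simp add: power2_eq_square)

lemma ip_self_nonneg: "0 \<le> ip f f"
  unfolding ip_def by (rule integral_nonneg_AE) auto

lemma ip_diff_left:
  assumes "f \<in> V" "g \<in> V" "k \<in> V"
  shows "ip (\<lambda>\<omega>. f \<omega> - g \<omega>) k = ip f k - ip g k"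
  unfolding ip_def left_diff_distrib
  by (rule Bochner_Integration.integral_diff) (intro integrable_mult_V assms)+

lemma ip_diff_right:
  assumes "f \<in> V" "g \<in> V" "k \<in> V"
  shows "ip k (\<lambda>\<omega>. f \<omega> - g \<omega>) = ip k f - ip k g"
  using ip_diff_left[OF assms] by (simp add: ip_commute)

lemma ip_scale_left: "ip (\<lambda>\<omega>. c * f \<omega>) g = c * ip f g"
  unfolding ip_def by (simp add: mult.assoc)

lemma ip_sum_left:
  assumes "\<And>i. i \<in> I \<Longrightarrow> f i \<in> V" "k \<in> V"
  shows "ip (\<lambda>\<omega>. \<Sum>i\<in>I. f i \<omega>) k = (\<Sum>i\<in>I. ip (f i) k)"
  unfolding ip_def sum_distrib_right
  by (rule Bochner_Integration.integral_sum) (intro integrable_mult_V assms)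

text \<open>The quadratic t \<mapsto> \<open>ip (f - t g) (f - t g)\<close> is nonnegative. Since
  \<open>ip\<close> is only semidefinite on functions, a direction g of zero norm is treated
  separately.\<close>

lemma ip_Cauchy_Schwarz:
  assumes f: "f \<in> V" and g: "g \<in> V"
  shows "(ip f g)\<^sup>2 \<le> ip f f * ip g g"
proof -
  have quad: "0 \<le> ip f f - 2 * t * ip f g + t\<^sup>2 * ip g g" for t
  proof -
    let ?k = "\<lambda>\<omega>. f \<omega> - t * g \<omega>"
    have tg: "(\<lambda>\<omega>. t * g \<omega>) \<in> V" using g by (rule lin_span.scale)
    have k: "?k \<in> V" using f tg by (rule lin_span_diff)
    have "ip ?k ?k = ip f ?k - t * ip g ?k"
      using ip_diff_left[OF f tg k] by (simp add: ip_scale_left)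
    also have "ip f ?k = ip f f - t * ip f g"
      using ip_diff_right[OF f tg f] ip_commute[of f "\<lambda>\<omega>. t * g \<omega>"] by (simp add: ip_scale_left ip_commute)
    also have "ip g ?k = ip f g - t * ip g g"
      using ip_diff_right[OF f tg g] ip_commute[of g "\<lambda>\<omega>. t * g \<omega>"] by (simp add: ip_scale_left ip_commute)
    finally show ?thesis
      using ip_self_nonneg[of ?k] by (simp add: power2_eq_square algebra_simps)
  qed
  show ?thesis
  proof (cases "ip g g = 0")
    case True
    have "ip f g = 0"
    proof (rule ccontr)
      assume ne: "ip f g \<noteq> 0"
      \<comment> \<open>Without its quadratic term the polynomial is affine in t; this t gives it
        the value -1.\<close>
      have "0 \<le> ip f f - 2 * ((ip f f + 1) / (2 * ip f g)) * ip f g"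
        using quad[of "(ip f f + 1) / (2 * ip f g)"] True by simp
      then show False using ne by (simp add: field_simps)
    qed
    then show ?thesis using True by simp
  next
    case False
    then have pos: "ip g g > 0" using ip_self_nonneg[of g] by simp
    have "0 \<le> ip f f - (ip f g)\<^sup>2 / ip g g"
      using quad[of "ip f g / ip g g"] pos by (simp add: power2_eq_square)
    then show ?thesis using pos by (simp add: field_simps)
  qed
qed

lemma W_in_V: "t \<in> {0..1} \<Longrightarrow> W t \<in> V"
  by (rule lin_span.base)

lemma ip_W:
  assumes "s \<in> {0..1}" "t \<in> {0..1}"
  shows "ip (W s) (W t) = (s powr (2 * H) + t powr (2 * H) - \<bar>t - s\<bar> powr (2 * H)) / 2"
  unfolding ip_def using fbm assms unfolding fractional_brownian_motion_def by blast

lemma ip_increments: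
  assumes "s \<in> {0..1}" "t \<in> {0..1}" "u \<in> {0..1}" "v \<in> {0..1}"
  shows "ip (\<lambda>\<omega>. W t \<omega> - W s \<omega>) (\<lambda>\<omega>. W v \<omega> - W u \<omega>) =
    (\<bar>v - s\<bar> powr (2 * H) + \<bar>u - t\<bar> powr (2 * H)
      - \<bar>v - t\<bar> powr (2 * H) - \<bar>u - s\<bar> powr (2 * H)) / 2"
proof -
  have "ip (\<lambda>\<omega>. W t \<omega> - W s \<omega>) (\<lambda>\<omega>. W v \<omega> - W u \<omega>) =
      ip (W t) (W v) - ip (W t) (W u) - (ip (W s) (W v) - ip (W s) (W u))"
    using assms by (simp add: ip_diff_left ip_diff_right W_in_V lin_span_diff)
  then show ?thesis
    using assms by (simp add: ip_W field_simps)
qed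

lemma ip_increment_self:
  assumes "s \<in> {0..1}" "t \<in> {0..1}"
  shows "ip (\<lambda>\<omega>. W t \<omega> - W s \<omega>) (\<lambda>\<omega>. W t \<omega> - W s \<omega>) = \<bar>t - s\<bar> powr (2 * H)"
  using assms by (simp add: ip_increments abs_minus_commute)

text \<open>For disjoint intervals with gap d and lengths h, k the covariance is half the mixed
  second difference of x^(2H) at d. The remaining factor |2H (2H - 1)| / 2 is at most 1.\<close>

lemma ip_separated_increments:
  assumes "0 \<le> s" "s \<le> t" "t < u" "u \<le> v" "v \<le> 1"
  shows "\<bar>ip (\<lambda>\<omega>. W t \<omega> - W s \<omega>) (\<lambda>\<omega>. W v \<omega> - W u \<omega>)\<bar>
    \<le> (u - t) powr (2 * H - 2) * (t - s) * (v - u)"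
proof -
  define d h k where "d = u - t" and "h = v - u" and "k = t - s"
  have dhk: "d > 0" "h \<ge> 0" "k \<ge> 0" using assms by (auto simp: d_def h_def k_def)
  have "ip (\<lambda>\<omega>. W t \<omega> - W s \<omega>) (\<lambda>\<omega>. W v \<omega> - W u \<omega>) =
    ((d + h + k) powr (2 * H) - (d + h) powr (2 * H) - (d + k) powr (2 * H) + d powr (2 * H)) / 2"
    using assms by (subst ip_increments) (auto simp: d_def h_def k_def)
  also have "\<bar>\<dots>\<bar> \<le> \<bar>2 * H * (2 * H - 1)\<bar> * d powr (2 * H - 2) * h * k / 2"
    using second_difference_powr_bound[OF dhk, of "2 * H"] H_less_1 by simp
  also have "\<dots> \<le> 2 * d powr (2 * H - 2) * h * k / 2"
  proof -
    have "\<bar>2 * H * (2 * H - 1)\<bar> = 2 * (H * \<bar>2 * H - 1\<bar>)"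
      using H_pos by (simp add: abs_mult)
    also have "\<dots> \<le> 2 * (1 * 1)"
      using H_pos H_less_1 by (intro mult_left_mono mult_mono) auto
    finally show ?thesis
      using dhk by (intro divide_right_mono mult_right_mono) auto
  qed
  finally show ?thesis by (simp add: d_def h_def k_def mult_ac)
qed

text \<open>The covariance gives W(0) the variance 0, as \<open>0 powr (2 * H) = 0\<close>. The
  bridge thus vanishes at both ends of the unit interval, on which all exact identities on the grid
  rest.\<close>

lemma AE_W_0: "AE \<omega> in M. W 0 \<omega> = 0"
proof -
  have "expectation (\<lambda>\<omega>. (W 0 \<omega>)\<^sup>2) = 0"
    using ip_W[of 0 0] by (simp add: ip_self)
  moreover have "integrable M (\<lambda>\<omega>. (W 0 \<omega>)\<^sup>2)"
    by (intro gaussian_rv_square_integrable gaussian W_in_V) auto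
  ultimately have "AE \<omega> in M. (W 0 \<omega>)\<^sup>2 = 0"
    by (subst integral_nonneg_eq_0_iff_AE[symmetric]) auto
  then show ?thesis by simp
qed

lemma AE_continuous: "AE \<omega> in M. continuous_on {0..1} (\<lambda>t. W t \<omega>)"
  using fbm by (simp add: fractional_brownian_motion_def)

end

section \<open>Variances of increment differences\<close>

text \<open>Stated for an arbitrary function, since it is applied to the paths of W, of the bridge
  and of Y, and to \<open>\<kappa>\<close>.\<close>

definition gincr :: "nat \<Rightarrow> (real \<Rightarrow> real) \<Rightarrow> nat \<Rightarrow> nat \<Rightarrow> real" where
  "gincr b f m j = f ((real j + 1) / real b ^ m) - f (real j / real b ^ m)"

locale weierstrass_bridge = fbm M H W for M :: "'a measure" and H :: real and W :: "real \<Rightarrow> 'a \<Rightarrow> real" +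
  fixes \<alpha> \<tau> C\<^sub>\<kappa> :: real and b :: nat and \<kappa> :: "real \<Rightarrow> real"
  assumes \<alpha>_pos: "0 < \<alpha>" and \<alpha>_less_1: "\<alpha> < 1"
    and b_ge_2: "b \<ge> 2"
    and \<kappa>_0: "\<kappa> 0 = 0" and \<kappa>_1: "\<kappa> 1 = 1"
    and H_less_\<tau>: "H < \<tau>"
    and C\<^sub>\<kappa>_nonneg: "0 \<le> C\<^sub>\<kappa>"
    and \<kappa>_hoelder: "\<And>s t. s \<in> {0..1} \<Longrightarrow> t \<in> {0..1} \<Longrightarrow>
      \<bar>\<kappa> s - \<kappa> t\<bar> \<le> C\<^sub>\<kappa> * \<bar>s - t\<bar> powr \<tau>"
begin

abbreviation "\<beta> \<equiv> real b"

definition sd :: "nat \<Rightarrow> real" where "sd m = \<beta> powr (- H * real m)"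

definition dW :: "nat \<Rightarrow> nat \<Rightarrow> 'a \<Rightarrow> real" where
  "dW m j \<omega> = gincr b (\<lambda>t. W t \<omega>) m j"

definition dB :: "nat \<Rightarrow> nat \<Rightarrow> 'a \<Rightarrow> real" where
  "dB m j \<omega> = gincr b (\<lambda>t. fractional_bridge \<kappa> W t \<omega>) m j"

text \<open>The ratio of the weighted standard deviations of successive levels,
  \<open>(1 / \<alpha>) ^ l * sd l\<close>. It equals b to the power -log_b(\<alpha>) - H, so it is
  below 1 exactly if K < H.\<close>

definition \<xi> where "\<xi> = \<beta> powr (- H) / \<alpha>"

lemma \<beta>_ge_2: "\<beta> \<ge> 2"
  using b_ge_2 by simp

lemma b_pos[simp]: "0 < b"
  using b_ge_2 by simp

lemma \<beta>_pos: "\<beta> > 0"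
  by simp

lemma sd_pos[simp]: "sd m > 0"
  using \<beta>_pos by (simp add: sd_def)

lemma sd_nonneg[simp]: "sd m \<ge> 0" and sd_nonzero[simp]: "sd m \<noteq> 0"
  using sd_pos[of m] by linarith+

lemma sd_add: "sd (m + n) = sd m * sd n"
  unfolding sd_def powr_add[symmetric] by (simp add: algebra_simps)

lemma sd_eq: "sd m = (1 / \<beta> ^ m) powr H"
proof -
  have "1 / \<beta> ^ m = \<beta> powr (- real m)"
    using b_ge_2 by (simp add: powr_minus powr_realpow divide_inverse)
  then show ?thesis by (simp add: sd_def powr_powr mult.commute)
qed

lemma sd_square: "(sd m)\<^sup>2 = (1 / \<beta> ^ m) powr (2 * H)"
  unfolding sd_eq by (simp add: power2_eq_square powr_add[symmetric])

lemma \<xi>_power: "(1 / \<alpha>) ^ l * sd l = \<xi> ^ l"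
proof -
  have "sd l = (\<beta> powr (- H)) ^ l"
    unfolding sd_def using b_ge_2 by (simp add: powr_power mult.commute)
  then show ?thesis
    unfolding \<xi>_def by (simp add: power_divide power_one_over field_simps)
qed

lemma \<xi>_pos: "\<xi> > 0"
  using \<alpha>_pos \<beta>_pos by (simp add: \<xi>_def)

lemma dB_eq: "dB m j = (\<lambda>\<omega>. dW m j \<omega> - gincr b \<kappa> m j * W 1 \<omega>)"
  unfolding dB_def dW_def gincr_def fractional_bridge_def by (auto simp: algebra_simps)

section \<open>Covariances of increments over grid cells\<close>

lemma grid_in_unit:
  assumes "j < b ^ m"
  shows "real j / \<beta> ^ m \<in> {0..1}" "(real j + 1) / \<beta> ^ m \<in> {0..1}"
proof -
  have "real j + 1 = real (j + 1)" by simp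
  also have "\<dots> \<le> real (b ^ m)"
    using assms by (intro of_nat_mono) simp
  finally have le: "real j + 1 \<le> \<beta> ^ m" by simp
  have pos: "\<beta> ^ m > 0" by simp
  from le pos assms show "real j / \<beta> ^ m \<in> {0..1}" "(real j + 1) / \<beta> ^ m \<in> {0..1}"
    by (auto simp: field_simps)
qed

lemma dW_in_V: "j < b ^ m \<Longrightarrow> dW m j \<in> V"
  unfolding dW_def gincr_def by (intro lin_span_diff W_in_V grid_in_unit)

lemma W1_in_V: "W 1 \<in> V"
  by (rule W_in_V) auto

lemma dB_in_V: "j < b ^ m \<Longrightarrow> dB m j \<in> V"
  unfolding dB_eq by (intro lin_span_diff dW_in_V lin_span.scale W1_in_V)

lemma grid_step: "(real j + 1) / \<beta> ^ m - real j / \<beta> ^ m = 1 / \<beta> ^ m"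
  by (simp add: diff_divide_distrib[symmetric])

lemma ip_dW_self:
  assumes "j < b ^ m"
  shows "ip (dW m j) (dW m j) = (sd m)\<^sup>2"
  using ip_increment_self[OF grid_in_unit(1)[OF assms] grid_in_unit(2)[OF assms]]
  unfolding dW_def gincr_def grid_step sd_square by simp

lemma ip_W1_self: "ip (W 1) (W 1) = 1"
  using ip_W[of 1 1] by simp

lemma ip_dW_le:
  assumes "j < b ^ m" "i < b ^ n"
  shows "\<bar>ip (dW m j) (dW n i)\<bar> \<le> sd m * sd n"
proof -
  have "(ip (dW m j) (dW n i))\<^sup>2 \<le> (sd m * sd n)\<^sup>2"
    using ip_Cauchy_Schwarz[OF dW_in_V[OF assms(1)] dW_in_V[OF assms(2)]] assms
    by (simp add: ip_dW_self power_mult_distrib)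
  then show ?thesis
    by (rule abs_le_square_iff[THEN iffD2, of _ "sd m * sd n", simplified abs_of_pos sd_pos, THEN order_trans])
       (simp add: abs_mult less_imp_le)
qed

lemma ip_W1_dW_le:
  assumes "i < b ^ n"
  shows "\<bar>ip (W 1) (dW n i)\<bar> \<le> sd n"
proof -
  have "(ip (W 1) (dW n i))\<^sup>2 \<le> (sd n)\<^sup>2"
    using ip_Cauchy_Schwarz[OF W1_in_V dW_in_V[OF assms]] assms
    by (simp add: ip_dW_self ip_W1_self)
  then show ?thesis
    using abs_le_square_iff[of "ip (W 1) (dW n i)" "sd n"] sd_pos[of n] by simp
qed

text \<open>The exponent splits as \<tau> = (\<tau> - H) + H: the part H reproduces
  \<open>sd (m + l)\<close>, the rest is a gain over the Gaussian scale. The gain is kept at the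
  base level m only, so that it is uniform in l.\<close>

lemma gincr_\<kappa>_le:
  assumes "j < b ^ (m + l)"
  shows "\<bar>gincr b \<kappa> (m + l) j\<bar> \<le> C\<^sub>\<kappa> * (1 / \<beta> ^ m) powr (\<tau> - H) * sd m * sd l"
proof -
  have "\<bar>gincr b \<kappa> (m + l) j\<bar> \<le> C\<^sub>\<kappa> * (1 / \<beta> ^ (m + l)) powr \<tau>"
    using \<kappa>_hoelder[OF grid_in_unit(2)[OF assms] grid_in_unit(1)[OF assms]]
    unfolding gincr_def grid_step by simp
  also have "\<dots> = C\<^sub>\<kappa> * ((1 / \<beta> ^ (m + l)) powr (\<tau> - H) * sd (m + l))"
    unfolding sd_eq powr_add[symmetric] by simp
  also have "\<dots> \<le> C\<^sub>\<kappa> * ((1 / \<beta> ^ m) powr (\<tau> - H) * sd (m + l))"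
    using b_ge_2 H_less_\<tau> C\<^sub>\<kappa>_nonneg sd_pos[of "m + l"]
    by (intro mult_left_mono mult_right_mono powr_mono2 divide_left_mono power_increasing) auto
  finally show ?thesis
    by (simp add: sd_add mult_ac)
qed

text \<open>A gap of at least 1 / (4 b) bounds the singular factor, leaving the product of the cell
  lengths. It is small compared with \<open>sd m * sd (m + l)\<close> because H < 1.\<close>

lemma ip_dW_separated_le:
  assumes j: "j < b ^ (m + l)" and i: "i < b ^ m"
    and sep: "(real j + 1) / \<beta> ^ (m + l) + 1 / (4 * \<beta>) \<le> real i / \<beta> ^ m"
  shows "\<bar>ip (dW (m + l) j) (dW m i)\<bar> \<le> (4 * \<beta>)\<^sup>2 * (1 / \<beta> ^ m) powr (2 - 2 * H) * (sd m)\<^sup>2 * sd l"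
proof -
  let ?s = "real j / \<beta> ^ (m + l)" and ?t = "(real j + 1) / \<beta> ^ (m + l)"
    and ?u = "real i / \<beta> ^ m" and ?v = "(real i + 1) / \<beta> ^ m"
  have gap: "1 / (4 * \<beta>) \<le> ?u - ?t" using sep by simp
  have gap_pos: "0 < 1 / (4 * \<beta>)" by simp
  have st: "?t - ?s = 1 / \<beta> ^ (m + l)" and uv: "?v - ?u = 1 / \<beta> ^ m"
    by (rule grid_step)+
  have pos: "0 < 1 / \<beta> ^ (m + l)" "0 < 1 / \<beta> ^ m" by simp_all
  have st_le: "?s \<le> ?t" and tu_less: "?t < ?u" and uv_le: "?u \<le> ?v"
    using st uv gap gap_pos pos by linarith+
  have "\<bar>ip (dW (m + l) j) (dW m i)\<bar> \<le> (?u - ?t) powr (2 * H - 2) * (?t - ?s) * (?v - ?u)"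
    unfolding dW_def gincr_def using grid_in_unit[OF j] grid_in_unit[OF i]
    by (intro ip_separated_increments st_le tu_less uv_le) auto
  also have "\<dots> = (?u - ?t) powr (2 * H - 2) * (1 / \<beta> ^ (m + l)) * (1 / \<beta> ^ m)"
    unfolding st uv ..
  also have "\<dots> \<le> (4 * \<beta>)\<^sup>2 * (1 / \<beta> ^ (m + l)) * (1 / \<beta> ^ m)"
  proof (intro mult_right_mono)
    \<comment> \<open>The exponent 2H - 2 is negative, so the smallest admissible gap is the worst
      case.\<close>
    have "(?u - ?t) powr (2 * H - 2) \<le> (1 / (4 * \<beta>)) powr (2 * H - 2)"
      using gap gap_pos H_less_1 by (intro powr_mono2') auto
    also have "\<dots> = (4 * \<beta>) powr (2 - 2 * H)"
      by (simp add: powr_divide powr_minus_divide[symmetric])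
    also have "\<dots> \<le> (4 * \<beta>) powr 2"
      using \<beta>_ge_2 H_pos by (intro powr_mono) auto
    finally show "(?u - ?t) powr (2 * H - 2) \<le> (4 * \<beta>)\<^sup>2"
      by (simp add: powr_numeral)
  qed auto
  also have "\<dots> = (4 * \<beta>)\<^sup>2 * ((1 / \<beta> ^ m)\<^sup>2 * (1 / \<beta> ^ l))"
    by (simp add: power_add power2_eq_square mult.assoc)
  also have "\<dots> \<le> (4 * \<beta>)\<^sup>2 * ((1 / \<beta> ^ m)\<^sup>2 * sd l)"
  proof -
    have "\<beta> powr (- real l) \<le> sd l"
      unfolding sd_def using \<beta>_ge_2 H_less_1 by (intro powr_mono) (auto simp: mult_left_le_one_le H_pos less_imp_le)
    then show ?thesis
      by (intro mult_left_mono) (auto simp: powr_minus powr_realpow divide_inverse)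
  qed
  also have "(1 / \<beta> ^ m)\<^sup>2 = (1 / \<beta> ^ m) powr (2 - 2 * H) * (sd m)\<^sup>2"
    unfolding sd_square powr_add[symmetric] by (simp add: powr_numeral)
  finally show ?thesis by (simp add: mult_ac)
qed

text \<open>The relative error of covariances at base level m: the first summand comes from
  separated increments of W, the second from the \<open>\<kappa>\<close>-correction of the bridge.
  Both exponents are positive, by H < 1 and H < \<tau>.\<close>

definition \<rho> :: "nat \<Rightarrow> real" where
  "\<rho> m = (4 * \<beta>)\<^sup>2 * (1 / \<beta> ^ m) powr (2 - 2 * H) + C\<^sub>\<kappa> * (1 / \<beta> ^ m) powr (\<tau> - H)"

lemma \<rho>_nonneg: "0 \<le> \<rho> m"
  unfolding \<rho>_def using C\<^sub>\<kappa>_nonneg by simp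

lemma ip_\<kappa>_part_le:
  assumes "j < b ^ (m + l)" "i < b ^ m"
  shows "\<bar>gincr b \<kappa> (m + l) j * ip (W 1) (dW m i)\<bar>
    \<le> C\<^sub>\<kappa> * (1 / \<beta> ^ m) powr (\<tau> - H) * (sd m)\<^sup>2 * sd l"
proof -
  have "\<bar>gincr b \<kappa> (m + l) j * ip (W 1) (dW m i)\<bar>
      \<le> (C\<^sub>\<kappa> * (1 / \<beta> ^ m) powr (\<tau> - H) * sd m * sd l) * sd m"
    unfolding abs_mult
    by (intro mult_mono gincr_\<kappa>_le ip_W1_dW_le assms)
       (use C\<^sub>\<kappa>_nonneg in auto)
  then show ?thesis by (simp add: power2_eq_square mult_ac)
qed

lemma ip_dB:
  assumes "j < b ^ (m + l)" "i < b ^ m"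
  shows "ip (dB (m + l) j) (dW m i)
    = ip (dW (m + l) j) (dW m i) - gincr b \<kappa> (m + l) j * ip (W 1) (dW m i)"
  unfolding dB_eq using assms
  by (simp add: ip_diff_left dW_in_V lin_span.scale W1_in_V ip_scale_left)

lemma ip_dB_separated_le:
  assumes "j < b ^ (m + l)" "i < b ^ m"
    and "(real j + 1) / \<beta> ^ (m + l) + 1 / (4 * \<beta>) \<le> real i / \<beta> ^ m"
  shows "\<bar>ip (dB (m + l) j) (dW m i)\<bar> \<le> \<rho> m * (sd m)\<^sup>2 * sd l"
  using ip_dW_separated_le[OF assms] ip_\<kappa>_part_le[OF assms(1,2)]
  unfolding ip_dB[OF assms(1,2)] \<rho>_def distrib_right by linarith

text \<open>The substitute for cells in arbitrary position: Cauchy-Schwarz contributes the summand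
  1.\<close>

lemma ip_dB_le:
  assumes "j < b ^ (m + l)" "i < b ^ m"
  shows "\<bar>ip (dB (m + l) j) (dW m i)\<bar> \<le> (\<rho> m + 1) * (sd m)\<^sup>2 * sd l"
proof -
  have "\<bar>ip (dW (m + l) j) (dW m i)\<bar> \<le> (sd m)\<^sup>2 * sd l"
    using ip_dW_le[OF assms] by (simp add: sd_add power2_eq_square mult_ac)
  moreover have "C\<^sub>\<kappa> * (1 / \<beta> ^ m) powr (\<tau> - H) * (sd m)\<^sup>2 * sd l \<le> \<rho> m * (sd m)\<^sup>2 * sd l"
    unfolding \<rho>_def by (intro mult_right_mono) auto
  ultimately show ?thesis
    using ip_\<kappa>_part_le[OF assms] unfolding ip_dB[OF assms] distrib_right by linarith
qed

text \<open>The difference D_n(p + b^r) - D_n(p) divided by \<alpha>^(n - r - 1), with N = n - r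
  (see \<open>gincr_Y_diff\<close>). In this normalisation the coarsest surviving level has weight
  1, and its increment alone fixes the order of the variance.\<close>

definition S :: "nat \<Rightarrow> nat \<Rightarrow> nat \<Rightarrow> 'a \<Rightarrow> real" where
  "S r N p = (\<lambda>\<omega>. \<Sum>l<N. (1 / \<alpha>) ^ l *
    (dB (r + 1 + l) ((p + b ^ r) mod b ^ (r + 1 + l)) \<omega> - dB (r + 1 + l) (p mod b ^ (r + 1 + l)) \<omega>))"

lemma mod_power_less[simp]: "p mod b ^ n < b ^ n"
  using b_ge_2 by simp

lemma S_in_V: "S r N p \<in> V"
  unfolding S_def by (intro lin_span_sum lin_span.scale lin_span_diff dB_in_V mod_power_less)

text \<open>In base b, the digits r, ..., r + L of p are 0: truncation to r + 1 + l digits keeps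
  only those below r, and adding b^r turns digit r into 1 without a carry.\<close>

lemma vanishing_digits_mod:
  assumes z: "(p div b ^ r) mod b ^ (L + 1) = 0" and l: "l \<le> L"
  shows "p mod b ^ (r + 1 + l) = p mod b ^ r"
    and "(p + b ^ r) mod b ^ (r + 1 + l) = p mod b ^ r + b ^ r"
proof -
  obtain t where t: "p div b ^ r = b ^ (L + 1) * t"
    using z by (auto elim: dvdE)
  have "b ^ r * b ^ (L + 1) = b ^ (r + 1 + l) * b ^ (L - l)"
    using l by (simp flip: power_add)
  moreover have "p = p mod b ^ r + b ^ r * (p div b ^ r)" by simp
  ultimately have p: "p = p mod b ^ r + b ^ (r + 1 + l) * (b ^ (L - l) * t)"
    using t by (metis mult.assoc)
  have s: "p mod b ^ r < b ^ r" by (rule mod_power_less)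
  \<comment> \<open>Room for the digit 1 at position r: p mod b^r + b^r stays below 2 b^r.\<close>
  have "2 * b ^ r \<le> b ^ (r + 1)" using b_ge_2 by simp
  also have "\<dots> \<le> b ^ (r + 1 + l)" using b_ge_2 by (intro power_increasing) auto
  finally have two: "2 * b ^ r \<le> b ^ (r + 1 + l)" .
  have "p mod b ^ (r + 1 + l) = (p mod b ^ r) mod b ^ (r + 1 + l)"
    by (subst p) (simp only: mod_mult_self2)
  also have "\<dots> = p mod b ^ r"
    by (rule mod_less) (use s two in linarith)
  finally show "p mod b ^ (r + 1 + l) = p mod b ^ r" .
  have "p + b ^ r = (p mod b ^ r + b ^ r) + b ^ (r + 1 + l) * (b ^ (L - l) * t)"
    using p by linarith
  then have "(p + b ^ r) mod b ^ (r + 1 + l) = (p mod b ^ r + b ^ r) mod b ^ (r + 1 + l)"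
    by (simp only: mod_mult_self2)
  also have "\<dots> = p mod b ^ r + b ^ r"
    by (rule mod_less) (use s two in linarith)
  finally show "(p + b ^ r) mod b ^ (r + 1 + l) = p mod b ^ r + b ^ r" .
qed

text \<open>The cell index stays fixed while the mesh gets finer, so the cell is pushed towards 0,
  away from the test cell. The second claim needs l \<ge> 1, since for l = 0 the changed cell is the
  test cell.\<close>

lemma changed_cell_separated:
  assumes s: "s < b ^ r" and r: "r \<ge> 2"
  shows "(real s + 1) / \<beta> ^ (r + 1 + l) + 1 / (4 * \<beta>) \<le> real (s + b ^ r) / \<beta> ^ (r + 1)"
    and "l \<ge> 1 \<Longrightarrow>
      (real (s + b ^ r) + 1) / \<beta> ^ (r + 1 + l) + 1 / (4 * \<beta>) \<le> real (s + b ^ r) / \<beta> ^ (r + 1)"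
proof -
  define g where "g = \<beta> ^ r"
  \<comment> \<open>This is the purpose of r \<ge> 2: g \<ge> 4 absorbs the width of the cell next
    to the required gap.\<close>
  have "2 ^ 2 \<le> \<beta> ^ 2" using \<beta>_ge_2 by (intro power_mono) auto
  also have "\<dots> \<le> g" unfolding g_def using \<beta>_ge_2 r by (intro power_increasing) auto
  finally have g: "g \<ge> 4" by simp
  \<comment> \<open>The right end of the cell decreases in l, which leaves only the levels l = 0 and
    l = 1 to be checked.\<close>
  have shift: "(y + 1) / \<beta> ^ (r + 1 + l) \<le> (y + 1) / (g * \<beta> * \<beta> ^ k)" if "y \<ge> 0" "k \<le> l" for y k
  proof -
    have "g * \<beta> * \<beta> ^ k = \<beta> ^ (r + 1 + k)" by (simp add: g_def power_add)
    also have "\<dots> \<le> \<beta> ^ (r + 1 + l)" using that \<beta>_ge_2 by (intro power_increasing) auto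
    finally show ?thesis using that g by (intro divide_left_mono mult_pos_pos) auto
  qed
  have rhs: "real (s + b ^ r) / \<beta> ^ (r + 1) = (real s + g) / (g * \<beta>)"
    by (simp add: g_def)
  have "(real s + 1) / (g * \<beta>) + 1 / (4 * \<beta>) \<le> (real s + g) / (g * \<beta>)"
    using g by (simp add: field_simps)
  then show "(real s + 1) / \<beta> ^ (r + 1 + l) + 1 / (4 * \<beta>) \<le> real (s + b ^ r) / \<beta> ^ (r + 1)"
    unfolding rhs using shift[of "real s" 0] by simp
  assume l: "l \<ge> 1"
  define y where "y = real s + g"
  have y: "y \<ge> g" by (simp add: y_def)
  have "(y + 1) / (g * \<beta> * \<beta>) \<le> (y + 1) / (g * \<beta> * 2)"
    using \<beta>_ge_2 y g by (intro divide_left_mono mult_left_mono) auto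
  moreover have "y / (g * \<beta>) - (y + 1) / (g * \<beta> * 2) - 1 / (4 * \<beta>) = (2 * y - 2 - g) / (4 * g * \<beta>)"
    using g by (simp add: field_simps)
  moreover have "(2 * y - 2 - g) / (4 * g * \<beta>) \<ge> 0"
    using g y by (intro divide_nonneg_nonneg) auto
  ultimately have "(y + 1) / (g * \<beta> * \<beta>) + 1 / (4 * \<beta>) \<le> y / (g * \<beta>)" by linarith
  then show "(real (s + b ^ r) + 1) / \<beta> ^ (r + 1 + l) + 1 / (4 * \<beta>) \<le> real (s + b ^ r) / \<beta> ^ (r + 1)"
    unfolding rhs using shift[of y 1] l y g by (simp add: y_def g_def)
qed

(* S is tested against the increment of W at the changed digit: the other increments with
   index at most L are separated from it, those beyond L are small. *)
lemma ip_S_self_lower: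
  assumes r: "r \<ge> 2" and N: "N \<ge> 1" and z: "(p div b ^ r) mod b ^ (L + 1) = 0"
    and err: "2 * \<rho> (r + 1) * (\<Sum>l<N. \<xi> ^ l) + 2 * (\<Sum>l\<in>{L<..<N}. \<xi> ^ l) \<le> 1 / 2"
  shows "(sd (r + 1) / 2)\<^sup>2 \<le> ip (S r N p) (S r N p)"
proof -
  define m where "m = r + 1"
  define s where "s = p mod b ^ r"
  define i where "i = s + b ^ r"
  define T where "T = dW m i"
  define v where "v = (sd m)\<^sup>2"
  define c where "c l = ip (dB (m + l) ((p + b ^ r) mod b ^ (m + l))) T
      - ip (dB (m + l) (p mod b ^ (m + l))) T" for l
  have v: "v > 0" by (simp add: v_def)
  have s: "s < b ^ r" by (simp add: s_def)
  then have "i < 2 * b ^ r" by (simp add: i_def)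
  also have "\<dots> \<le> b ^ m" using b_ge_2 by (simp add: m_def)
  finally have i: "i < b ^ m" .
  have T: "T \<in> V" unfolding T_def using i by (rule dW_in_V)
  have TT: "ip T T = v" unfolding T_def v_def using i by (rule ip_dW_self)
  have low: "p mod b ^ (m + l) = s" "(p + b ^ r) mod b ^ (m + l) = i" if "l \<le> L" for l
    using vanishing_digits_mod[OF z that] by (simp_all add: m_def s_def i_def)
  \<comment> \<open>The ideal value of \<open>c l\<close> is the variance v for l = 0, where the
    changed cell is the test cell, and 0 otherwise. The digits of p beyond position r + L are
    unrestricted, so for l > L only the bound 2 from two applications of \<open>ip_dB_le\<close> is
    left.\<close>
  have c_bound: "\<bar>c l - (if l = 0 then v else 0)\<bar> \<le> v * sd l * (2 * \<rho> m + (if L < l then 2 else 0))" for l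
  proof -
    consider "l = 0" | "1 \<le> l" "l \<le> L" | "L < l" by linarith
    then show ?thesis
    proof cases
      case 1
      have "i < b ^ (m + 0)" "s < b ^ (m + 0)" using i by (auto simp: i_def)
      note B = ip_dB[OF this(1) i] ip_\<kappa>_part_le[OF this(1) i]
        ip_dB_separated_le[OF this(2) i]
      have "\<bar>ip (dB m s) T\<bar> \<le> \<rho> m * v * sd 0"
        using B(3) changed_cell_separated(1)[OF s r, of 0] by (simp add: m_def i_def T_def v_def)
      moreover have "\<bar>ip (dB m i) T - v\<bar> \<le> \<rho> m * v * sd 0"
      proof -
        have "\<bar>ip (dB m i) T - v\<bar> \<le> C\<^sub>\<kappa> * (1 / \<beta> ^ m) powr (\<tau> - H) * v * sd 0"
          using B(1,2) TT by (simp add: T_def v_def)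
        also have "\<dots> \<le> \<rho> m * v * sd 0"
          unfolding \<rho>_def using v by (intro mult_right_mono) auto
        finally show ?thesis .
      qed
      moreover have "c l = ip (dB m i) T - ip (dB m s) T"
        using low[of 0] 1 by (simp add: c_def)
      ultimately have "\<bar>c l - v\<bar> \<le> \<rho> m * v * sd 0 + \<rho> m * v * sd 0" by linarith
      with 1 show ?thesis by (simp add: algebra_simps)
    next
      case 2
      have "i < b ^ (m + l)" "s < b ^ (m + l)"
        using low[of l] 2 mod_power_less[of "p + b ^ r" "m + l"] mod_power_less[of p "m + l"] by auto
      note B = ip_dB_separated_le[OF this(1) i] ip_dB_separated_le[OF this(2) i]
      have "\<bar>ip (dB (m + l) i) T\<bar> \<le> \<rho> m * v * sd l" "\<bar>ip (dB (m + l) s) T\<bar> \<le> \<rho> m * v * sd l"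
        using B changed_cell_separated[OF s r, of l] 2(1) by (simp_all add: m_def i_def T_def v_def)
      moreover have "c l = ip (dB (m + l) i) T - ip (dB (m + l) s) T"
        using low[of l] 2 by (simp add: c_def)
      ultimately have "\<bar>c l\<bar> \<le> \<rho> m * v * sd l + \<rho> m * v * sd l" by linarith
      with 2 show ?thesis by (simp add: algebra_simps)
    next
      case 3
      have "\<bar>c l\<bar> \<le> (\<rho> m + 1) * v * sd l + (\<rho> m + 1) * v * sd l"
        using ip_dB_le[OF mod_power_less[of "p + b ^ r"] i, where l=l] ip_dB_le[OF mod_power_less[of p] i, where l=l]
        unfolding c_def T_def v_def by linarith
      with 3 show ?thesis by (simp add: algebra_simps)
    qed
  qed
  have ST: "ip (S r N p) T = (\<Sum>l<N. (1 / \<alpha>) ^ l * c l)"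
    unfolding S_def c_def
    by (subst ip_sum_left) (auto simp: T ip_scale_left ip_diff_left dB_in_V lin_span_diff m_def
        intro!: lin_span.scale)
  have "\<bar>ip (S r N p) T - v\<bar> = \<bar>\<Sum>l<N. (1 / \<alpha>) ^ l * (c l - (if l = 0 then v else 0))\<bar>"
  proof -
    have "(\<Sum>l<N. (1 / \<alpha>) ^ l * (if l = 0 then v else 0)) = (\<Sum>l\<in>{0}. (1 / \<alpha>) ^ l * v)"
      using N by (intro sum.mono_neutral_cong_right) auto
    then have "(\<Sum>l<N. (1 / \<alpha>) ^ l * (if l = 0 then v else 0)) = v" by simp
    then show ?thesis
      unfolding ST right_diff_distrib sum_subtractf by simp
  qed
  also have "\<dots> \<le> (\<Sum>l<N. \<bar>(1 / \<alpha>) ^ l * (c l - (if l = 0 then v else 0))\<bar>)"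
    by (rule sum_abs)
  also have "\<dots> \<le> (\<Sum>l<N. (1 / \<alpha>) ^ l * (v * sd l * (2 * \<rho> m + (if L < l then 2 else 0))))"
    unfolding abs_mult using c_bound \<alpha>_pos by (intro sum_mono mult_mono) auto
  also have "\<dots> = (\<Sum>l<N. v * (2 * \<rho> m * \<xi> ^ l + (if L < l then 2 * \<xi> ^ l else 0)))"
    by (intro sum.cong) (auto simp: \<xi>_power[symmetric] algebra_simps)
  also have "\<dots> = v * (2 * \<rho> m * (\<Sum>l<N. \<xi> ^ l) + (\<Sum>l<N. if L < l then 2 * \<xi> ^ l else 0))"
    by (simp only: sum_distrib_left sum.distrib distrib_left)
  also have "(\<Sum>l<N. if L < l then 2 * \<xi> ^ l else 0) = 2 * (\<Sum>l\<in>{L<..<N}. \<xi> ^ l)"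
    unfolding sum_distrib_left by (intro sum.mono_neutral_cong_right) auto
  also have "v * (2 * \<rho> m * (\<Sum>l<N. \<xi> ^ l) + 2 * (\<Sum>l\<in>{L<..<N}. \<xi> ^ l)) \<le> v * (1 / 2)"
    using err v by (intro mult_left_mono) (auto simp: m_def)
  finally have "v / 2 \<le> ip (S r N p) T" by linarith
  then have "(v / 2)\<^sup>2 \<le> (ip (S r N p) T)\<^sup>2"
    using v by (intro power_mono) auto
  \<comment> \<open>A covariance of at least v / 2 with a variable of variance v forces a variance
    of at least v / 4.\<close>
  also have "\<dots> \<le> ip (S r N p) (S r N p) * v"
    using ip_Cauchy_Schwarz[OF S_in_V T] TT by simp
  finally have "v / 4 \<le> ip (S r N p) (S r N p)"
    using v by (simp add: power2_eq_square field_simps)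
  then show ?thesis by (simp add: v_def m_def power_divide)
qed

end

section \<open>Increments of the bridge on the grid\<close>

lemma frac_nat_divide: "frac (real k / real c) = real (k mod c) / real c"
proof (cases "c = 0")
  case False
  have "real k = real (c * (k div c) + k mod c)" by simp
  then have "real k = real c * real (k div c) + real (k mod c)"
    by (simp only: of_nat_add of_nat_mult)
  then have "real k / real c = real (k div c) + real (k mod c) / real c"
    using False by (simp add: field_simps)
  then show ?thesis
    unfolding frac_def by (simp add: floor_divide_of_nat_eq)
qed simp

text \<open>On each [k, k + 1] the function agrees with x \<mapsto> f(x - k), at the right end
  because f 0 = f 1; finitely many closed pieces are glued.\<close>

lemma continuous_on_compose_frac:
  fixes f :: "real \<Rightarrow> real"
  assumes f: "continuous_on {0..1} f" and f01: "f 0 = f 1"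
  shows "continuous_on {0..1} (\<lambda>t. f (frac (real c * t)))"
proof (cases "c = 0")
  case False
  have piece: "continuous_on {real k..real k + 1} (\<lambda>x. f (frac x))" for k :: nat
  proof -
    have "continuous_on {real k..real k + 1} (\<lambda>x. f (x - real k))"
      by (intro continuous_on_compose2[OF f] continuous_intros) auto
    also have "?this \<longleftrightarrow> ?thesis"
    proof (rule continuous_on_cong)
      fix x assume x: "x \<in> {real k..real k + 1}"
      show "f (x - real k) = f (frac x)"
      proof (cases "x = real k + 1")
        case True
        then have "x = real (Suc k)" by simp
        then have frac0: "frac x = 0" by (simp only: frac_def floor_of_nat of_int_of_nat_eq diff_self)
        show ?thesis unfolding frac0 using True f01 by simp
      next
        case False
        with x have "frac x = x - real k"
          by (subst frac_unique_iff) auto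
        then show ?thesis by simp
      qed
    qed simp
    finally show ?thesis .
  qed
  have "continuous_on (\<Union>k\<in>{..<c}. {real k..real k + 1}) (\<lambda>x. f (frac x))"
    by (intro continuous_on_closed_Union piece) auto
  moreover have "(\<lambda>t. real c * t) ` {0..1} \<subseteq> (\<Union>k\<in>{..<c}. {real k..real k + 1})"
  proof (clarify)
    fix t :: real assume t: "t \<in> {0..1}"
    show "real c * t \<in> (\<Union>k\<in>{..<c}. {real k..real k + 1})"
    \<comment> \<open>At t = 1 the floor would select piece c, which lies outside the range; the
      last piece c - 1 contains this point as its right end.\<close>
    proof (cases "t = 1")
      case True
      with False have "real c * t \<in> {real (c - 1)..real (c - 1) + 1}" "c - 1 \<in> {..<c}"
        by (auto simp: of_nat_diff)
      then show ?thesis by blast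
    next
      case t1: False
      define k where "k = nat \<lfloor>real c * t\<rfloor>"
      have k: "real k \<le> real c * t" "real c * t < real k + 1"
        using t by (simp_all add: k_def)
      moreover have "real c * t < real c * 1"
        using t t1 False by (intro mult_strict_left_mono) auto
      ultimately have "k < c" by simp
      with k have "real c * t \<in> {real k..real k + 1}" "k \<in> {..<c}" by auto
      then show ?thesis by blast
    qed
  qed
  ultimately show ?thesis
    by (intro continuous_on_compose2[of _ "\<lambda>x. f (frac x)" _ "\<lambda>t. real c * t"] continuous_intros)
qed simp

lemma power_variation_eq:
  "b > 0 \<Longrightarrow> power_variation b q n f 1 = (\<Sum>k<b ^ n. \<bar>gincr b f n k\<bar> powr q)"
  unfolding power_variation_def gincr_def by (simp flip: of_nat_power)

context weierstrass_bridge
begin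

section \<open>Continuity, grid values and grid increments of Y\<close>

abbreviation Y :: "'a \<Rightarrow> real \<Rightarrow> real" where
  "Y \<omega> \<equiv> (\<lambda>t. wiener_weierstrass_bridge \<alpha> b \<kappa> W t \<omega>)"

lemma bridge_0: "W 0 \<omega> = 0 \<Longrightarrow> fractional_bridge \<kappa> W 0 \<omega> = 0"
  by (simp add: fractional_bridge_def \<kappa>_0)

lemma bridge_1: "fractional_bridge \<kappa> W 1 \<omega> = 0"
  by (simp add: fractional_bridge_def \<kappa>_1)

lemma \<tau>_pos: "\<tau> > 0"
  using H_pos H_less_\<tau> by simp

lemma continuous_\<kappa>: "continuous_on {0..1} \<kappa>"
  unfolding continuous_on_def
proof
  fix s :: real assume s: "s \<in> {0..1}"
  have "((\<lambda>t. C\<^sub>\<kappa> * \<bar>t - s\<bar> powr \<tau>) \<longlongrightarrow> C\<^sub>\<kappa> * \<bar>s - s\<bar> powr \<tau>) (at s within {0..1})"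
    using \<tau>_pos by (intro tendsto_intros) auto
  then have "((\<lambda>t. C\<^sub>\<kappa> * \<bar>t - s\<bar> powr \<tau>) \<longlongrightarrow> 0) (at s within {0..1})"
    by simp
  then have "((\<lambda>t. \<kappa> t - \<kappa> s) \<longlongrightarrow> 0) (at s within {0..1})"
  proof (rule Lim_null_comparison[rotated])
    show "\<forall>\<^sub>F t in at s within {0..1}. norm (\<kappa> t - \<kappa> s) \<le> C\<^sub>\<kappa> * \<bar>t - s\<bar> powr \<tau>"
      using s \<kappa>_hoelder by (auto simp: eventually_at_filter)
  qed
  then show "(\<kappa> \<longlongrightarrow> \<kappa> s) (at s within {0..1})"
    by (simp add: LIM_zero_iff)
qed

text \<open>Weierstrass M-test with the majorant \<alpha>^n sup |B|; the periodic continuation of B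
  is continuous because B takes the same value at 0 and 1.\<close>

lemma continuous_Y:
  assumes W: "continuous_on {0..1} (\<lambda>t. W t \<omega>)" and W0: "W 0 \<omega> = 0"
  shows "continuous_on {0..1} (Y \<omega>)"
proof -
  define B where "B = (\<lambda>t. fractional_bridge \<kappa> W t \<omega>)"
  have B: "continuous_on {0..1} B"
    unfolding B_def fractional_bridge_def by (intro continuous_intros W continuous_\<kappa>)
  have B01: "B 0 = B 1"
    unfolding B_def by (simp add: bridge_0[OF W0] bridge_1)
  have "bounded (B ` {0..1})"
    by (intro compact_imp_bounded compact_continuous_image B) auto
  then obtain K where "\<forall>y\<in>B ` {0..1}. norm y \<le> K"
    unfolding bounded_iff by blast
  then have K: "\<bar>B t\<bar> \<le> K" if "t \<in> {0..1}" for t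
    using that by auto
  have "uniform_limit {0..1} (\<lambda>n t. \<Sum>i<n. \<alpha> ^ i * B (frac (real b ^ i * t)))
     (\<lambda>t. \<Sum>i. \<alpha> ^ i * B (frac (real b ^ i * t))) sequentially"
  proof (rule Weierstrass_m_test)
    fix n and t :: real
    have "frac (real b ^ n * t) \<in> {0..1}"
      using frac_lt_1[of "real b ^ n * t"] by (auto simp: less_imp_le)
    then show "norm (\<alpha> ^ n * B (frac (real b ^ n * t))) \<le> \<alpha> ^ n * K"
      using \<alpha>_pos by (auto simp: abs_mult intro!: mult_left_mono K)
  next
    show "summable (\<lambda>n. \<alpha> ^ n * K)"
      using \<alpha>_pos \<alpha>_less_1 by (intro summable_mult2 summable_geometric) auto
  qed
  moreover have "continuous_on {0..1} (\<lambda>t. \<Sum>i<n. \<alpha> ^ i * B (frac (real b ^ i * t)))" for n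
    using continuous_on_compose_frac[OF B B01, of "b ^ _"]
    by (intro continuous_intros) simp
  ultimately have "continuous_on {0..1} (\<lambda>t. \<Sum>i. \<alpha> ^ i * B (frac (real b ^ i * t)))"
    by (intro uniform_limit_theorem) auto
  then show ?thesis
    unfolding wiener_weierstrass_bridge_def B_def .
qed

text \<open>At k / b^n the series is finite: for m \<ge> n the argument b^m k / b^n is an integer,
  its fractional part is 0, and so is the bridge there.\<close>

lemma Y_grid:
  assumes W0: "W 0 \<omega> = 0"
  shows "Y \<omega> (real k / \<beta> ^ n) =
    (\<Sum>m<n. \<alpha> ^ m * fractional_bridge \<kappa> W (real (k mod b ^ (n - m)) / \<beta> ^ (n - m)) \<omega>)"
proof -
  have "Y \<omega> (real k / \<beta> ^ n) =
      (\<Sum>m. \<alpha> ^ m * fractional_bridge \<kappa> W (frac (\<beta> ^ m * (real k / \<beta> ^ n))) \<omega>)"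
    by (simp add: wiener_weierstrass_bridge_def)
  also have "\<dots> = (\<Sum>m<n. \<alpha> ^ m * fractional_bridge \<kappa> W (frac (\<beta> ^ m * (real k / \<beta> ^ n))) \<omega>)"
  proof (rule suminf_finite)
    fix m assume "m \<notin> {..<n}"
    then have "\<beta> ^ m = \<beta> ^ (m - n) * \<beta> ^ n" by (simp flip: power_add)
    then have "\<beta> ^ m * (real k / \<beta> ^ n) = real (b ^ (m - n) * k)"
      using b_ge_2 by simp
    then show "\<alpha> ^ m * fractional_bridge \<kappa> W (frac (\<beta> ^ m * (real k / \<beta> ^ n))) \<omega> = 0"
      by (simp only: frac_def floor_of_nat of_int_of_nat_eq diff_self bridge_0[OF W0] mult_zero_right of_int_0)
  qed simp
  also have "\<dots> = (\<Sum>m<n. \<alpha> ^ m * fractional_bridge \<kappa> W (real (k mod b ^ (n - m)) / \<beta> ^ (n - m)) \<omega>)"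
  proof (intro sum.cong refl)
    fix m assume "m \<in> {..<n}"
    then have "\<beta> ^ n = \<beta> ^ m * \<beta> ^ (n - m)" by (simp flip: power_add)
    then have "\<beta> ^ m * (real k / \<beta> ^ n) = real k / real (b ^ (n - m))"
      using b_ge_2 by simp
    then show "\<alpha> ^ m * fractional_bridge \<kappa> W (frac (\<beta> ^ m * (real k / \<beta> ^ n))) \<omega> =
        \<alpha> ^ m * fractional_bridge \<kappa> W (real (k mod b ^ (n - m)) / \<beta> ^ (n - m)) \<omega>"
      by (simp only: frac_nat_divide) simp
  qed
  finally show ?thesis .
qed

(* When k + 1 is divisible by b^m, the fractional part jumps from the last cell to 0
   instead of reaching 1, where the bridge has the same value. *)
lemma dB_mod:
  assumes W0: "W 0 \<omega> = 0"
  shows "fractional_bridge \<kappa> W (real ((k + 1) mod b ^ m) / \<beta> ^ m) \<omega>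
      - fractional_bridge \<kappa> W (real (k mod b ^ m) / \<beta> ^ m) \<omega> = dB m (k mod b ^ m) \<omega>"
proof (cases "Suc (k mod b ^ m) = b ^ m")
  case True
  then have "(k + 1) mod b ^ m = 0" by (simp add: mod_Suc)
  moreover have "real (k mod b ^ m) + 1 = \<beta> ^ m"
    using arg_cong[OF True, of real] by simp
  ultimately show ?thesis
    by (simp add: dB_def gincr_def bridge_0[OF W0] bridge_1)
next
  case False
  then have "(k + 1) mod b ^ m = Suc (k mod b ^ m)" by (simp add: mod_Suc)
  then show ?thesis
    by (simp add: dB_def gincr_def add.commute)
qed

lemma gincr_Y:
  assumes W0: "W 0 \<omega> = 0"
  shows "gincr b (Y \<omega>) n k = (\<Sum>m<n. \<alpha> ^ m * dB (n - m) (k mod b ^ (n - m)) \<omega>)"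
proof -
  have "gincr b (Y \<omega>) n k = Y \<omega> (real (k + 1) / \<beta> ^ n) - Y \<omega> (real k / \<beta> ^ n)"
    by (simp add: gincr_def add.commute)
  then show ?thesis
    unfolding Y_grid[OF W0] sum_subtractf[symmetric] right_diff_distrib[symmetric] dB_mod[OF W0] .
qed

text \<open>For m \<le> r the number b^m divides b^r, so both indices have the same residue and
  level m cancels.\<close>

lemma gincr_Y_diff:
  assumes W0: "W 0 \<omega> = 0" and r: "r < n"
  shows "gincr b (Y \<omega>) n (p + b ^ r) - gincr b (Y \<omega>) n p = \<alpha> ^ (n - r - 1) * S r (n - r) p \<omega>"
proof -
  define d where "d m = dB m ((p + b ^ r) mod b ^ m) \<omega> - dB m (p mod b ^ m) \<omega>" for m
  have d0: "d m = 0" if "m \<le> r" for m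
  proof -
    have "b ^ m dvd b ^ r" using that by (rule le_imp_power_dvd)
    then have "(p + b ^ r) mod b ^ m = p mod b ^ m"
      by (metis dvd_eq_mod_eq_0 mod_add_right_eq add.right_neutral)
    then show ?thesis by (simp add: d_def)
  qed
  have "gincr b (Y \<omega>) n (p + b ^ r) - gincr b (Y \<omega>) n p = (\<Sum>m<n. \<alpha> ^ m * d (n - m))"
    unfolding gincr_Y[OF W0] d_def sum_subtractf[symmetric] right_diff_distrib ..
  also have "\<dots> = (\<Sum>m<n - r. \<alpha> ^ m * d (n - m))"
    by (rule sum.mono_neutral_right) (auto intro!: d0)
  \<comment> \<open>Reversed summation: l now counts upwards from the coarsest surviving level r +
    1, whose weight \<alpha>^(n - r - 1) is then factored out.\<close>
  also have "\<dots> = (\<Sum>l<n - r. \<alpha> ^ (n - r - Suc l) * d (n - (n - r - Suc l)))"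
    by (rule sum.nat_diff_reindex[symmetric])
  also have "\<dots> = (\<Sum>l<n - r. \<alpha> ^ (n - r - 1) * ((1 / \<alpha>) ^ l * d (r + 1 + l)))"
  proof (intro sum.cong refl)
    fix l assume l: "l \<in> {..<n - r}"
    then have "n - (n - r - Suc l) = r + 1 + l" by auto
    moreover have "n - r - 1 = (n - r - Suc l) + l" using l by auto
    then have "\<alpha> ^ (n - r - 1) * (1 / \<alpha>) ^ l = \<alpha> ^ (n - r - Suc l)"
      using \<alpha>_pos by (simp add: power_add power_one_over)
    ultimately show "\<alpha> ^ (n - r - Suc l) * d (n - (n - r - Suc l)) =
        \<alpha> ^ (n - r - 1) * ((1 / \<alpha>) ^ l * d (r + 1 + l))"
      by (simp only: mult.assoc[symmetric])
  qed
  also have "\<dots> = \<alpha> ^ (n - r - 1) * S r (n - r) p \<omega>"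
    unfolding S_def d_def sum_distrib_left ..
  finally show ?thesis .
qed

(* Adding b^r to such an index only changes its digit number r. *)
definition idx :: "nat \<Rightarrow> nat \<Rightarrow> nat \<Rightarrow> nat set" where
  "idx n r L = {p. p < b ^ n \<and> (p div b ^ r) mod b ^ (L + 1) = 0}"

lemma finite_idx: "finite (idx n r L)"
  by (simp add: idx_def)

lemma idx_nonempty: "idx n r L \<noteq> {}"
proof -
  have "0 \<in> idx n r L" by (simp add: idx_def)
  then show ?thesis by blast
qed

text \<open>The map f inserts L + 1 zero digits at position r into a number with n - 1 - L digits,
  and this is injective.\<close>

lemma card_idx:
  assumes n: "r + L + 1 \<le> n"
  shows "b ^ (n - 1 - L) \<le> card (idx n r L)"
proof -
  define f where "f q = q mod b ^ r + b ^ r * (b ^ (L + 1) * (q div b ^ r))" for q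
  have f_mod: "f q mod b ^ r = q mod b ^ r" and f_div: "f q div b ^ r = b ^ (L + 1) * (q div b ^ r)" for q
    by (simp_all add: f_def)
  have "inj f"
  proof (rule injI)
    fix q q' assume "f q = f q'"
    then have "q mod b ^ r = q' mod b ^ r" "b ^ (L + 1) * (q div b ^ r) = b ^ (L + 1) * (q' div b ^ r)"
      using f_mod f_div by metis+
    then show "q = q'"
      using b_pos by (metis div_mult_mod_eq mult_cancel_left power_not_zero less_not_refl2)
  qed
  moreover have "f ` {..<b ^ (n - 1 - L)} \<subseteq> idx n r L"
  proof clarify
    fix q assume q: "q < b ^ (n - 1 - L)"
    have "n - 1 - L = r + (n - (r + L + 1))" using n by simp
    then have "q div b ^ r < b ^ (n - (r + L + 1))"
      using q by (simp add: power_add less_mult_imp_div_less mult.commute)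
    then have "q div b ^ r + 1 \<le> b ^ (n - (r + L + 1))" by simp
    then have "b ^ (r + L + 1) * (q div b ^ r + 1) \<le> b ^ (r + L + 1) * b ^ (n - (r + L + 1))"
      by (rule mult_le_mono2)
    also have "\<dots> = b ^ n" using n by (simp flip: power_add del: power_Suc)
    finally have "b ^ (r + L + 1) * (q div b ^ r) + b ^ (r + L + 1) \<le> b ^ n" by simp
    moreover have "q mod b ^ r < b ^ r" by (rule mod_power_less)
    moreover have "b ^ r \<le> b ^ (r + L + 1)" using b_ge_2 by (intro power_increasing) auto
    moreover have "b ^ r * (b ^ (L + 1) * (q div b ^ r)) = b ^ (r + L + 1) * (q div b ^ r)"
      by (simp add: power_add)
    ultimately have "f q < b ^ n" unfolding f_def by linarith
    then show "f q \<in> idx n r L"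
      unfolding idx_def by (simp add: f_div del: power_Suc)
  qed
  ultimately have "card {..<b ^ (n - 1 - L)} \<le> card (idx n r L)"
    by (intro card_inj_on_le) (auto intro: inj_on_subset finite_idx)
  then show ?thesis by simp
qed

text \<open>Adding b^r causes no carry out of the lowest r + L + 1 digits, so p + b^r stays in the
  block of length b^(r + L + 1) that contains p, and b^n is a multiple of this length.\<close>

lemma idx_shift:
  assumes n: "r + L + 1 \<le> n" and p: "p \<in> idx n r L"
  shows "p + b ^ r < b ^ n"
proof -
  let ?c = "b ^ (r + L + 1)"
  have n': "b ^ n = ?c * b ^ (n - (r + L + 1))"
    using n by (simp flip: power_add del: power_Suc)
  have z: "(p div b ^ r) mod b ^ (L + 1) = 0" and pn: "p < b ^ n"
    using p by (auto simp: idx_def)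
  have m: "p mod ?c = p mod b ^ r" "(p + b ^ r) mod ?c = p mod b ^ r + b ^ r"
    using vanishing_digits_mod[OF z, of L] by (simp_all add: add.commute add.left_commute del: power_Suc)
  have "p mod b ^ r + b ^ r < ?c"
    using mod_power_less[of "p + b ^ r" "r + L + 1"] by (simp only: m(2))
  moreover have "p = p mod ?c + ?c * (p div ?c)" by simp
  ultimately have "p + b ^ r < ?c * (p div ?c + 1)"
    unfolding distrib_left mult_1_right m(1) by linarith
  also have "p div ?c < b ^ (n - (r + L + 1))"
    using pn n' by (simp add: less_mult_imp_div_less mult.commute del: power_Suc)
  then have "?c * (p div ?c + 1) \<le> ?c * b ^ (n - (r + L + 1))"
    by (intro mult_le_mono2) simp
  finally show ?thesis using n' by simp
qed

text \<open>One of two increments is at least half as large as their difference. Of the denominator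
  4, one factor 2 is due to keeping only half of the indices, the other to bounding the sums over p
  and over p + b^r separately by the whole variation.\<close>

lemma power_variation_Y_ge:
  assumes W0: "W 0 \<omega> = 0" and n: "r + L + 1 \<le> n" and q: "q > 0" and e: "e \<ge> 0"
    and many: "real (card (idx n r L)) / 2 \<le> real (card {p \<in> idx n r L. e \<le> \<bar>S r (n - r) p \<omega>\<bar>})"
  shows "\<beta> ^ (n - 1 - L) / 4 * (\<alpha> ^ (n - r - 1) * e / 2) powr q \<le> power_variation b q n (Y \<omega>) 1"
proof -
  define D where "D k = \<bar>gincr b (Y \<omega>) n k\<bar> powr q" for k
  define J where "J = {p \<in> idx n r L. e \<le> \<bar>S r (n - r) p \<omega>\<bar>}"
  let ?s = "(\<alpha> ^ (n - r - 1) * e / 2) powr q"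
  have J: "finite J" "J \<subseteq> idx n r L" by (auto simp: J_def finite_idx)
  have D_nonneg: "D k \<ge> 0" for k by (simp add: D_def)
  have V: "power_variation b q n (Y \<omega>) 1 = (\<Sum>k<b ^ n. D k)"
    unfolding D_def by (rule power_variation_eq) simp
  have "?s \<le> D p + D (p + b ^ r)" if "p \<in> J" for p
  proof -
    let ?a = "\<bar>gincr b (Y \<omega>) n p\<bar>" and ?b = "\<bar>gincr b (Y \<omega>) n (p + b ^ r)\<bar>"
    have "\<alpha> ^ (n - r - 1) * e \<le> \<alpha> ^ (n - r - 1) * \<bar>S r (n - r) p \<omega>\<bar>"
      using that \<alpha>_pos by (intro mult_left_mono) (auto simp: J_def)
    also have "\<dots> = \<bar>gincr b (Y \<omega>) n (p + b ^ r) - gincr b (Y \<omega>) n p\<bar>"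
      using gincr_Y_diff[OF W0, of r n p] n \<alpha>_pos by (simp add: abs_mult)
    also have "\<dots> \<le> ?a + ?b" by linarith
    finally have "\<alpha> ^ (n - r - 1) * e / 2 \<le> max ?a ?b" by linarith
    then have "?s \<le> (max ?a ?b) powr q"
      using q e \<alpha>_pos by (intro powr_mono2) auto
    also have "\<dots> \<le> D p + D (p + b ^ r)"
      by (auto simp: D_def max_def)
    finally show ?thesis .
  qed
  then have "(\<Sum>p\<in>J. ?s) \<le> (\<Sum>p\<in>J. D p + D (p + b ^ r))"
    by (rule sum_mono)
  also have "\<dots> = (\<Sum>p\<in>J. D p) + (\<Sum>k\<in>(\<lambda>p. p + b ^ r) ` J. D k)"
    by (subst sum.reindex) (auto simp: sum.distrib inj_on_def)
  also have "(\<Sum>p\<in>J. D p) \<le> (\<Sum>k<b ^ n. D k)"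
    using J by (intro sum_mono2) (auto simp: D_nonneg idx_def)
  also have "(\<Sum>k\<in>(\<lambda>p. p + b ^ r) ` J. D k) \<le> (\<Sum>k<b ^ n. D k)"
    using J idx_shift[OF n] by (intro sum_mono2) (auto simp: D_nonneg)
  finally have "real (card J) * ?s \<le> 2 * power_variation b q n (Y \<omega>) 1"
    using V by simp
  moreover have "\<beta> ^ (n - 1 - L) / 2 * ?s \<le> real (card J) * ?s"
  proof (rule mult_right_mono)
    have "\<beta> ^ (n - 1 - L) \<le> real (card (idx n r L))"
      using card_idx[OF n] by (metis of_nat_le_iff of_nat_power)
    then show "\<beta> ^ (n - 1 - L) / 2 \<le> real (card J)"
      using many unfolding J_def by linarith
  qed simp
  ultimately show ?thesis by simp
qed

end

section \<open>Lower bounds for the power variation\<close>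

lemma summable_inverse_square: "summable (\<lambda>n. 1 / (real n + 1) ^ 2)"
  using inverse_squares_sums by (simp add: sums_iff add.commute)

lemma exponential_beats_power_at_top:
  fixes c \<gamma> s :: real
  assumes "c > 0" "\<gamma> > 1"
  shows "filterlim (\<lambda>n. c * \<gamma> ^ n / (real n + 1) powr s) at_top sequentially"
  using assms by real_asymp

lemma exponential_beats_power_0:
  fixes c \<gamma> s :: real
  assumes "0 < \<gamma>" "\<gamma> < 1"
  shows "(\<lambda>n. c * \<gamma> ^ n * (real n + 1) powr s) \<longlonglongrightarrow> 0"
  using assms by real_asymp

context weierstrass_bridge
begin

lemma \<rho>_tendsto_0: "\<rho> \<longlonglongrightarrow> 0"
proof -
  have inv: "(\<lambda>m. 1 / \<beta> ^ m) \<longlonglongrightarrow> 0"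
    using \<beta>_ge_2 by (intro LIMSEQ_divide_realpow_zero) auto
  have "(\<lambda>m. (1 / \<beta> ^ m) powr s) \<longlonglongrightarrow> 0" if "s > 0" for s
    using tendsto_powr'[OF inv tendsto_const, of s] that by simp
  then have "(\<lambda>m. (4 * \<beta>)\<^sup>2 * (1 / \<beta> ^ m) powr (2 - 2 * H) + C\<^sub>\<kappa> * (1 / \<beta> ^ m) powr (\<tau> - H))
      \<longlonglongrightarrow> (4 * \<beta>)\<^sup>2 * 0 + C\<^sub>\<kappa> * 0"
    using H_less_1 H_less_\<tau> by (intro tendsto_intros) auto
  then show ?thesis unfolding \<rho>_def[abs_def] by simp
qed

text \<open>The exceptional set is determined by the variables S alone, so the quantifier over q can
  stand inside the almost sure statement. r and L may vary with n, to serve both choices of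
  r.\<close>

lemma AE_power_variation_lower:
  fixes r L :: "nat \<Rightarrow> nat"
  assumes ev: "eventually (\<lambda>n. r n \<ge> 2 \<and> r n + L n + 1 \<le> n \<and>
    2 * \<rho> (r n + 1) * (\<Sum>l<n - r n. \<xi> ^ l) + 2 * (\<Sum>l\<in>{L n<..<n - r n}. \<xi> ^ l) \<le> 1 / 2) sequentially"
  shows "AE \<omega> in M. eventually (\<lambda>n. \<forall>q>0. \<beta> ^ (n - 1 - L n) / 4 *
      (\<alpha> ^ (n - r n - 1) * (1 / (real n + 1)\<^sup>2 * (sd (r n + 1) / 2)) / 2) powr q
      \<le> power_variation b q n (Y \<omega>) 1) sequentially"
proof -
  \<comment> \<open>Serves both as the relative threshold and as the bound for the probability of
    falling below it.\<close>
  define \<delta> where "\<delta> n = 1 / (real n + 1) ^ 2" for n :: nat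
  have "AE \<omega> in M. eventually (\<lambda>n. real (card (idx n (r n) (L n))) / 2 \<le>
      real (card {p \<in> idx n (r n) (L n). \<delta> n * (sd (r n + 1) / 2) \<le> \<bar>S (r n) (n - r n) p \<omega>\<bar>}))
      sequentially"
  proof (rule AE_eventually_few_small)
    show "summable \<delta>" unfolding \<delta>_def by (rule summable_inverse_square)
    show "eventually (\<lambda>n. \<forall>p\<in>idx n (r n) (L n).
        prob {\<omega> \<in> space M. \<bar>S (r n) (n - r n) p \<omega>\<bar> < \<delta> n * (sd (r n + 1) / 2)} \<le> \<delta> n) sequentially"
      using ev
    proof eventually_elim
      case (elim n)
      show ?case
      proof
        fix p assume p: "p \<in> idx n (r n) (L n)"
        show "prob {\<omega> \<in> space M. \<bar>S (r n) (n - r n) p \<omega>\<bar> < \<delta> n * (sd (r n + 1) / 2)} \<le> \<delta> n"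
        proof (rule gaussian_small_ball)
          show "(sd (r n + 1) / 2)\<^sup>2 \<le> expectation (\<lambda>\<omega>. (S (r n) (n - r n) p \<omega>)\<^sup>2)"
            unfolding ip_self[symmetric] using elim p
            by (intro ip_S_self_lower[where L="L n"]) (auto simp: idx_def)
        qed (auto simp: \<delta>_def intro!: gaussian mean_V S_in_V)
      qed
    qed
  qed (auto simp: finite_idx idx_nonempty intro!: measurable_V S_in_V)
  with AE_W_0 show ?thesis
  proof eventually_elim
    case (elim \<omega>)
    from elim(2) ev show ?case
    proof eventually_elim
      case (elim n)
      show ?case
      proof (intro allI impI)
        fix q :: real assume "q > 0"
        then show "\<beta> ^ (n - 1 - L n) / 4 *
            (\<alpha> ^ (n - r n - 1) * (1 / (real n + 1)\<^sup>2 * (sd (r n + 1) / 2)) / 2) powr q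
            \<le> power_variation b q n (Y \<omega>) 1"
          using elim \<open>W 0 \<omega> = 0\<close> by (intro power_variation_Y_ge) (auto simp: \<delta>_def)
      qed
    qed
  qed
qed

text \<open>With r = n - 1 and L = 0 the sum over l < n - r is 1 and the tail is empty, so the error
  condition reduces to \<rho>(n) \<le> 1/4.\<close>

lemma AE_power_variation_at_top_H:
  "AE \<omega> in M. \<forall>q>0. q * H < 1 \<longrightarrow>
     filterlim (\<lambda>n. power_variation b q n (Y \<omega>) 1) at_top sequentially"
proof -
  have "eventually (\<lambda>m. \<rho> m < 1 / 4) sequentially"
    using \<rho>_tendsto_0 by (rule order_tendstoD) simp
  then have "eventually (\<lambda>n. n - 1 \<ge> 2 \<and> n - 1 + 0 + 1 \<le> n \<and>
    2 * \<rho> (n - 1 + 1) * (\<Sum>l<n - (n - 1). \<xi> ^ l) + 2 * (\<Sum>l\<in>{0<..<n - (n - 1)}. \<xi> ^ l) \<le> 1 / 2)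
    sequentially"
    using eventually_ge_at_top[of 3]
  proof eventually_elim
    case (elim n)
    then have "n - (n - 1) = 1" by simp
    moreover have "{0<..<1::nat} = {}" by auto
    ultimately show ?case using elim by simp
  qed
  from AE_power_variation_lower[of "\<lambda>n. n - 1" "\<lambda>_. 0", OF this] show ?thesis
  proof eventually_elim
    case (elim \<omega>)
    show ?case
    proof (intro allI impI)
      fix q :: real assume q: "q > 0" "q * H < 1"
      \<comment> \<open>b^n cells of size about b^(-Hn) each, raised to the power q.\<close>
      define \<gamma> where "\<gamma> = \<beta> powr (1 - q * H)"
      have \<gamma>: "\<gamma> > 1" using q \<beta>_ge_2 by (simp add: \<gamma>_def)
      have "filterlim (\<lambda>n. (1 / (4 * \<beta> * 4 powr q)) * \<gamma> ^ n / (real n + 1) powr (2 * q)) at_top sequentially"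
        using \<gamma> by (intro exponential_beats_power_at_top) auto
      then show "filterlim (\<lambda>n. power_variation b q n (Y \<omega>) 1) at_top sequentially"
      proof (rule filterlim_at_top_mono)
        show "\<forall>\<^sub>F n in sequentially. (1 / (4 * \<beta> * 4 powr q)) * \<gamma> ^ n / (real n + 1) powr (2 * q)
            \<le> power_variation b q n (Y \<omega>) 1"
          using elim eventually_ge_at_top[of 1]
        proof eventually_elim
          case (elim n)
          have \<gamma>n: "\<gamma> ^ n = \<beta> ^ n * sd n powr q"
          proof -
            have "\<gamma> ^ n = \<beta> powr ((1 - q * H) * real n)"
              unfolding \<gamma>_def by (simp add: powr_power mult.commute)
            also have "\<dots> = \<beta> powr real n * (\<beta> powr (- H * real n)) powr q"
              unfolding powr_powr powr_add[symmetric] by (simp add: algebra_simps)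
            finally show ?thesis by (simp add: sd_def powr_realpow)
          qed
          have sq: "(real n + 1) powr (2 * q) = ((real n + 1)\<^sup>2) powr q"
            by (simp add: powr_powr flip: powr_numeral)
          have "\<beta> ^ n = \<beta> * \<beta> ^ (n - 1)" using elim by (cases n) auto
          then have "(1 / (4 * \<beta> * 4 powr q)) * \<gamma> ^ n / (real n + 1) powr (2 * q)
              = \<beta> ^ (n - 1) / 4 * (sd n powr q / (4 powr q * ((real n + 1)\<^sup>2) powr q))"
            unfolding \<gamma>n sq using b_ge_2 by simp
          also have "sd n powr q / (4 powr q * ((real n + 1)\<^sup>2) powr q) = (sd n / (4 * (real n + 1)\<^sup>2)) powr q"
            by (simp add: powr_divide powr_mult)
          also have "sd n / (4 * (real n + 1)\<^sup>2) =
              \<alpha> ^ (n - (n - 1) - 1) * (1 / (real n + 1)\<^sup>2 * (sd (n - 1 + 1) / 2)) / 2"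
            using elim by simp
          finally show ?case
            using elim(1)[rule_format, OF q(1)] unfolding diff_zero by (rule ord_eq_le_trans)
        qed
      qed
    qed
  qed
qed

text \<open>For \<xi> < 1 the sums are bounded uniformly in the number of levels, so r and L can be
  fixed. Then b^(n - 1 - L) and \<alpha>^(n - r - 1) differ from b^n and \<alpha>^n by constants
  only.\<close>

lemma AE_power_variation_at_top_\<alpha>:
  assumes \<xi>: "\<xi> < 1"
  shows "AE \<omega> in M. \<forall>q>0. \<beta> * \<alpha> powr q > 1 \<longrightarrow>
     filterlim (\<lambda>n. power_variation b q n (Y \<omega>) 1) at_top sequentially"
proof -
  have tail: "(\<Sum>l\<in>{L<..<N}. \<xi> ^ l) \<le> \<xi> ^ L / (1 - \<xi>)" for L N
  proof -
    have "(\<Sum>l\<in>{L<..<N}. \<xi> ^ l) \<le> (\<Sum>l\<in>{L..<L + N}. \<xi> ^ l)"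
      using \<xi>_pos by (intro sum_mono2) auto
    also have "\<dots> = (\<Sum>l<N. \<xi> ^ (L + l))"
      using sum.shift_bounds_nat_ivl[of "\<lambda>l. \<xi> ^ l" 0 L N] by (simp add: lessThan_atLeast0 add.commute)
    also have "\<dots> = \<xi> ^ L * (\<Sum>l<N. \<xi> ^ l)"
      by (simp add: power_add sum_distrib_left)
    also have "(\<Sum>l<N. \<xi> ^ l) = (1 - \<xi> ^ N) / (1 - \<xi>)"
      using \<xi> by (subst sum_gp_strict) auto
    also have "\<xi> ^ L * ((1 - \<xi> ^ N) / (1 - \<xi>)) \<le> \<xi> ^ L * (1 / (1 - \<xi>))"
      using \<xi> \<xi>_pos by (intro mult_left_mono divide_right_mono) auto
    finally show ?thesis by simp
  qed
  have full: "(\<Sum>l<N. \<xi> ^ l) \<le> 1 / (1 - \<xi>)" for N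
    using \<xi> \<xi>_pos by (subst sum_gp_strict) (auto intro!: divide_right_mono)
  \<comment> \<open>The error budget 1/2 is split evenly: L makes twice the tail at most 1/4, and r
    makes 2 \<rho>(r + 1) / (1 - \<xi>) at most 1/4.\<close>
  have "(\<lambda>L. \<xi> ^ L / (1 - \<xi>)) \<longlonglongrightarrow> 0 / (1 - \<xi>)"
    using \<xi> \<xi>_pos by (intro tendsto_intros LIMSEQ_power_zero) auto
  then have "eventually (\<lambda>L. \<xi> ^ L / (1 - \<xi>) < 1 / 8) sequentially"
    by (rule order_tendstoD) simp
  then obtain L where L: "\<xi> ^ L / (1 - \<xi>) < 1 / 8"
    by (auto simp: eventually_sequentially)
  have "eventually (\<lambda>m. \<rho> m < (1 - \<xi>) / 8) sequentially"
    using \<rho>_tendsto_0 by (rule order_tendstoD) (use \<xi> in simp)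
  then obtain m0 where m0: "\<And>m. m \<ge> m0 \<Longrightarrow> \<rho> m < (1 - \<xi>) / 8"
    by (auto simp: eventually_sequentially)
  define r where "r = max 2 m0"
  have \<rho>: "\<rho> (r + 1) < (1 - \<xi>) / 8" by (rule m0) (simp add: r_def)
  have "eventually (\<lambda>n. r \<ge> 2 \<and> r + L + 1 \<le> n \<and>
    2 * \<rho> (r + 1) * (\<Sum>l<n - r. \<xi> ^ l) + 2 * (\<Sum>l\<in>{L<..<n - r}. \<xi> ^ l) \<le> 1 / 2) sequentially"
    using eventually_ge_at_top[of "r + L + 1"]
  proof eventually_elim
    case (elim n)
    have "2 * \<rho> (r + 1) * (\<Sum>l<n - r. \<xi> ^ l) \<le> 2 * ((1 - \<xi>) / 8) * (1 / (1 - \<xi>))"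
      using \<rho> full[of "n - r"] \<rho>_nonneg \<xi> \<xi>_pos by (intro mult_mono sum_nonneg) auto
    also have "\<dots> = 1 / 4" using \<xi> by (simp add: field_simps)
    finally have "2 * \<rho> (r + 1) * (\<Sum>l<n - r. \<xi> ^ l) \<le> 1 / 4" .
    moreover have "(\<Sum>l\<in>{L<..<n - r}. \<xi> ^ l) \<le> 1 / 8"
      using tail[of L "n - r"] L by linarith
    moreover have "r \<ge> 2" by (simp add: r_def)
    ultimately show ?case using elim by linarith
  qed
  from AE_power_variation_lower[of "\<lambda>_. r" "\<lambda>_. L", OF this] show ?thesis
  proof eventually_elim
    case (elim \<omega>)
    show ?case
    proof (intro allI impI)
      fix q :: real assume q: "q > 0" "\<beta> * \<alpha> powr q > 1"
      define \<gamma> where "\<gamma> = \<beta> * \<alpha> powr q"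
      define s where "s = sd (r + 1) / (4 * \<alpha> ^ (r + 1))"
      have s: "s > 0" using \<alpha>_pos by (simp add: s_def)
      define c where "c = s powr q / (4 * \<beta> ^ (L + 1))"
      have c: "c > 0" using s by (simp add: c_def)
      have "filterlim (\<lambda>n. c * \<gamma> ^ n / (real n + 1) powr (2 * q)) at_top sequentially"
        using c q by (intro exponential_beats_power_at_top) (auto simp: \<gamma>_def)
      then show "filterlim (\<lambda>n. power_variation b q n (Y \<omega>) 1) at_top sequentially"
      proof (rule filterlim_at_top_mono)
        show "\<forall>\<^sub>F n in sequentially. c * \<gamma> ^ n / (real n + 1) powr (2 * q)
            \<le> power_variation b q n (Y \<omega>) 1"
          using elim eventually_ge_at_top[of "r + L + 1"]
        proof eventually_elim
          case (elim n)
          have sq: "(real n + 1) powr (2 * q) = ((real n + 1)\<^sup>2) powr q"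
            by (simp add: powr_powr flip: powr_numeral)
          have "\<beta> ^ n = \<beta> ^ (L + 1) * \<beta> ^ (n - 1 - L)"
            using elim by (simp flip: power_add power_Suc)
          then have \<beta>n: "\<beta> ^ n / (4 * \<beta> ^ (L + 1)) = \<beta> ^ (n - 1 - L) / 4"
            using \<beta>_pos by (simp del: power_Suc)
          have "\<alpha> ^ n = \<alpha> ^ (r + 1) * \<alpha> ^ (n - r - 1)"
            using elim by (simp flip: power_add power_Suc)
          then have \<alpha>n: "\<alpha> ^ n * s = \<alpha> ^ (n - r - 1) * sd (r + 1) / 4"
            using \<alpha>_pos by (simp add: s_def del: power_Suc)
          have "\<gamma> ^ n = \<beta> ^ n * (\<alpha> ^ n) powr q"
            using \<alpha>_pos by (simp add: \<gamma>_def power_mult_distrib powr_power powr_powr mult.commute flip: powr_realpow)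
          then have "c * \<gamma> ^ n / (real n + 1) powr (2 * q)
              = \<beta> ^ (n - 1 - L) / 4 * ((\<alpha> ^ n) powr q * s powr q / ((real n + 1)\<^sup>2) powr q)"
            unfolding \<beta>n[symmetric] sq by (simp add: c_def)
          also have "(\<alpha> ^ n) powr q * s powr q / ((real n + 1)\<^sup>2) powr q = (\<alpha> ^ n * s / (real n + 1)\<^sup>2) powr q"
            using \<alpha>_pos s by (simp add: powr_divide powr_mult)
          also have "\<alpha> ^ n * s / (real n + 1)\<^sup>2 =
              \<alpha> ^ (n - r - 1) * (1 / (real n + 1)\<^sup>2 * (sd (r + 1) / 2)) / 2"
            unfolding \<alpha>n by simp
          finally show ?case
            using elim(1)[rule_format, OF q(1)] by (rule ord_eq_le_trans)
        qed
      qed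
    qed
  qed
qed

end

section \<open>Upper bounds for the power variation\<close>

context weierstrass_bridge
begin

text \<open>The slope ln b + 1 is chosen so that b^m tails of size exp (-(ln b + 1) m) add up to the
  summable exp (-m), up to a constant. The growth linear in m reflects the merely exponential tail
  bound.\<close>

lemma AE_eventually_dW_le:
  "AE \<omega> in M. eventually (\<lambda>m. \<forall>j<b ^ m. \<bar>dW m j \<omega>\<bar> \<le> (ln \<beta> + 1) * real m * sd m) sequentially"
proof -
  define A where "A m = (\<Union>j\<in>{..<b ^ m}. {\<omega> \<in> space M. (ln \<beta> + 1) * real m * sd m < \<bar>dW m j \<omega>\<bar>})" for m
  have A: "A m \<in> sets M" for m
    unfolding A_def
  proof (intro sets.finite_UN)
    fix j assume "j \<in> {..<b ^ m}"
    then have [measurable]: "dW m j \<in> borel_measurable M" by (intro measurable_V dW_in_V) simp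
    show "{\<omega> \<in> space M. (ln \<beta> + 1) * real m * sd m < \<bar>dW m j \<omega>\<bar>} \<in> sets M" by measurable
  qed simp
  have "prob (A m) \<le> 2 * exp (1 / 2) * exp (- 1) ^ m" for m
  proof -
    have "prob (A m) \<le> (\<Sum>j\<in>{..<b ^ m}. prob {\<omega> \<in> space M. (ln \<beta> + 1) * real m * sd m < \<bar>dW m j \<omega>\<bar>})"
      unfolding A_def
    proof (rule finite_measure_subadditive_finite)
      show "(\<lambda>j. {\<omega> \<in> space M. (ln \<beta> + 1) * real m * sd m < \<bar>dW m j \<omega>\<bar>}) ` {..<b ^ m} \<subseteq> events"
      proof clarify
        fix j assume "j < b ^ m"
        then have [measurable]: "dW m j \<in> borel_measurable M" by (intro measurable_V dW_in_V)
        show "{\<omega> \<in> space M. (ln \<beta> + 1) * real m * sd m < \<bar>dW m j \<omega>\<bar>} \<in> events" by measurable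
      qed
    qed simp
    also have "\<dots> \<le> (\<Sum>j\<in>{..<b ^ m}. 2 * exp (1 / 2 - (ln \<beta> + 1) * real m))"
      by (intro sum_mono gaussian_tail gaussian mean_V)
         (auto simp: dW_in_V ip_dW_self ip_self[symmetric])
    also have "\<dots> = 2 * exp (1 / 2) * (\<beta> ^ m * exp (- ((ln \<beta> + 1) * real m)))"
      unfolding diff_conv_add_uminus exp_add by simp
    also have "exp (- ((ln \<beta> + 1) * real m)) = (exp (- (ln \<beta> + 1))) ^ m"
      by (subst exp_of_nat_mult[symmetric]) (simp add: algebra_simps)
    also have "exp (- (ln \<beta> + 1)) = exp (- 1) / \<beta>"
      using \<beta>_pos by (simp add: exp_diff exp_minus field_simps exp_add)
    also have "\<beta> ^ m * (exp (- 1) / \<beta>) ^ m = exp (- 1) ^ m"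
      using b_ge_2 by (simp add: power_divide)
    finally show ?thesis .
  qed
  then have "\<forall>\<^sub>F m in sequentially. norm (prob (A m)) \<le> 2 * exp (1 / 2) * exp (- 1) ^ m"
    by (intro always_eventually allI) simp
  then have "summable (\<lambda>m. prob (A m))"
    by (rule summable_comparison_test_ev) (intro summable_mult summable_geometric; simp)
  then have "AE \<omega> in M. eventually (\<lambda>m. \<omega> \<in> space M - A m) sequentially"
    using A by (intro borel_cantelli_AE1) (auto simp: emeasure_eq_measure)
  then show ?thesis
  proof (rule AE_mp, intro AE_I2 impI)
    fix \<omega> assume "\<omega> \<in> space M" "eventually (\<lambda>m. \<omega> \<in> space M - A m) sequentially"
    from this(2) show "eventually (\<lambda>m. \<forall>j<b ^ m. \<bar>dW m j \<omega>\<bar> \<le> (ln \<beta> + 1) * real m * sd m) sequentially"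
      by eventually_elim (auto simp: A_def not_less)
  qed
qed

text \<open>Pathwise: the finitely many levels before the bound sets in are absorbed into a constant
  depending on \<omega>, and the \<open>\<kappa>\<close>-part adds a multiple of |W(1)|. The factor
  m + 1 replaces m, which would force the increment at level 0 to vanish.\<close>

lemma dB_uniform_bound:
  assumes ev: "eventually (\<lambda>m. \<forall>j<b ^ m. \<bar>dW m j \<omega>\<bar> \<le> (ln \<beta> + 1) * real m * sd m) sequentially"
  shows "\<exists>C\<ge>0. \<forall>m. \<forall>j<b ^ m. \<bar>dB m j \<omega>\<bar> \<le> C * (real m + 1) * sd m"
proof -
  obtain m0 where m0: "\<And>m j. m \<ge> m0 \<Longrightarrow> j < b ^ m \<Longrightarrow> \<bar>dW m j \<omega>\<bar> \<le> (ln \<beta> + 1) * real m * sd m"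
    using ev by (auto simp: eventually_sequentially)
  define c where "c m = (\<Sum>j<b ^ m. \<bar>dW m j \<omega>\<bar> / sd m)" for m
  define C\<^sub>0 where "C\<^sub>0 = (ln \<beta> + 1) + (\<Sum>m<m0. c m)"
  define C where "C = C\<^sub>0 + C\<^sub>\<kappa> * \<bar>W 1 \<omega>\<bar>"
  have ln: "ln \<beta> \<ge> 0" using \<beta>_ge_2 by simp
  have c: "c m \<ge> 0" for m by (auto simp: c_def intro!: sum_nonneg)
  have C0: "C\<^sub>0 \<ge> 0" using ln c by (auto simp: C\<^sub>0_def intro!: add_nonneg_nonneg sum_nonneg)
  have dW: "\<bar>dW m j \<omega>\<bar> \<le> C\<^sub>0 * (real m + 1) * sd m" if j: "j < b ^ m" for m j
  proof (cases "m \<ge> m0")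
    case True
    have "(ln \<beta> + 1) * real m * sd m \<le> C\<^sub>0 * (real m + 1) * sd m"
      using ln c C0 by (intro mult_right_mono mult_mono) (auto simp: C\<^sub>0_def intro!: sum_nonneg)
    with m0[OF True j] show ?thesis by linarith
  next
    case False
    have "\<bar>dW m j \<omega>\<bar> / sd m \<le> c m"
      unfolding c_def using j by (intro member_le_sum) auto
    also have "\<dots> \<le> (\<Sum>m<m0. c m)"
      using False c by (intro member_le_sum) auto
    also have "\<dots> \<le> C\<^sub>0" using ln by (simp add: C\<^sub>0_def)
    also have "\<dots> \<le> C\<^sub>0 * (real m + 1)" using C0 by (simp add: algebra_simps)
    finally show ?thesis by (simp add: pos_divide_le_eq)
  qed
  have "\<bar>dB m j \<omega>\<bar> \<le> C * (real m + 1) * sd m" if j: "j < b ^ m" for m j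
  proof -
    \<comment> \<open>The instance with base level 0, where the gain factor is 1.\<close>
    have "\<bar>gincr b \<kappa> m j\<bar> \<le> C\<^sub>\<kappa> * sd m"
      using gincr_\<kappa>_le[of j 0 m] j b_ge_2 by (simp add: sd_def)
    then have "\<bar>gincr b \<kappa> m j * W 1 \<omega>\<bar> \<le> C\<^sub>\<kappa> * sd m * \<bar>W 1 \<omega>\<bar>"
      unfolding abs_mult by (intro mult_right_mono) auto
    also have "\<dots> \<le> C\<^sub>\<kappa> * sd m * \<bar>W 1 \<omega>\<bar> * (real m + 1)"
      using C\<^sub>\<kappa>_nonneg by (simp add: algebra_simps)
    finally have "\<bar>dB m j \<omega>\<bar> \<le> C\<^sub>0 * (real m + 1) * sd m + C\<^sub>\<kappa> * sd m * \<bar>W 1 \<omega>\<bar> * (real m + 1)"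
      unfolding dB_eq using dW[OF j] by linarith
    then show ?thesis by (simp add: C_def algebra_simps)
  qed
  moreover have "C \<ge> 0" using C0 C\<^sub>\<kappa>_nonneg by (simp add: C_def)
  ultimately show ?thesis by blast
qed

text \<open>Both \<alpha>^m and \<open>sd (n - m)\<close> are dominated by powers of b^(-R), so all
  n terms of an increment obey one common bound. No distinction between H and -log_b(\<alpha>) is
  made: if they coincide, all terms have the same exponential order, and the number of terms is a
  polynomial factor.\<close>

lemma power_variation_tendsto_0:
  assumes W0: "W 0 \<omega> = 0" and C: "C \<ge> 0"
    and dB: "\<And>m j. j < b ^ m \<Longrightarrow> \<bar>dB m j \<omega>\<bar> \<le> C * (real m + 1) * sd m"
    and R: "R \<le> H" "R \<le> - log \<beta> \<alpha>" and q: "q > 0" "q * R > 1"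
  shows "(\<lambda>n. power_variation b q n (Y \<omega>) 1) \<longlonglongrightarrow> 0"
proof -
  have "\<alpha> = \<beta> powr (log \<beta> \<alpha>)"
    using \<alpha>_pos \<beta>_ge_2 by simp
  also have "\<dots> \<le> \<beta> powr (- R)"
    using R \<beta>_ge_2 by (intro powr_mono) auto
  finally have \<alpha>R: "\<alpha> \<le> \<beta> powr (- R)" .
  have sdR: "sd m \<le> (\<beta> powr (- R)) ^ m" for m
  proof -
    have "sd m \<le> \<beta> powr (- R * real m)"
      unfolding sd_def using R \<beta>_ge_2 by (intro powr_mono mult_right_mono) auto
    then show ?thesis by (simp add: powr_power mult.commute)
  qed
  have incr: "\<bar>gincr b (Y \<omega>) n k\<bar> \<le> C * (real n + 1)\<^sup>2 * (\<beta> powr (- R)) ^ n" for n k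
  proof -
    have "\<bar>gincr b (Y \<omega>) n k\<bar> \<le> (\<Sum>m<n. \<bar>\<alpha> ^ m * dB (n - m) (k mod b ^ (n - m)) \<omega>\<bar>)"
      unfolding gincr_Y[OF W0] by (rule sum_abs)
    also have "\<dots> \<le> (\<Sum>m<n. C * (real n + 1) * (\<beta> powr (- R)) ^ n)"
    proof (rule sum_mono)
      fix m assume m: "m \<in> {..<n}"
      have "\<bar>\<alpha> ^ m * dB (n - m) (k mod b ^ (n - m)) \<omega>\<bar>
          \<le> (\<beta> powr (- R)) ^ m * (C * (real (n - m) + 1) * sd (n - m))"
        unfolding abs_mult using \<alpha>R \<alpha>_pos dB[OF mod_power_less]
        by (intro mult_mono) (auto simp: power_abs intro!: power_mono)
      also have "\<dots> \<le> (\<beta> powr (- R)) ^ m * (C * (real n + 1) * (\<beta> powr (- R)) ^ (n - m))"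
        using C sdR by (intro mult_left_mono mult_mono) auto
      also have "\<dots> = C * (real n + 1) * ((\<beta> powr (- R)) ^ m * (\<beta> powr (- R)) ^ (n - m))"
        by (simp add: mult_ac)
      also have "(\<beta> powr (- R)) ^ m * (\<beta> powr (- R)) ^ (n - m) = (\<beta> powr (- R)) ^ n"
        using m by (simp flip: power_add)
      finally show "\<bar>\<alpha> ^ m * dB (n - m) (k mod b ^ (n - m)) \<omega>\<bar> \<le> C * (real n + 1) * (\<beta> powr (- R)) ^ n" .
    qed
    also have "\<dots> = real n * (C * (real n + 1) * (\<beta> powr (- R)) ^ n)"
      by simp
    also have "\<dots> \<le> (real n + 1) * (C * (real n + 1) * (\<beta> powr (- R)) ^ n)"
      using C by (intro mult_right_mono) auto
    finally show ?thesis by (simp add: power2_eq_square mult_ac)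
  qed
  define \<gamma> where "\<gamma> = \<beta> powr (1 - q * R)"
  have \<gamma>: "0 < \<gamma>" "\<gamma> < 1" using q \<beta>_ge_2 by (simp_all add: \<gamma>_def powr_less_one)
  have bound: "power_variation b q n (Y \<omega>) 1 \<le> C powr q * \<gamma> ^ n * (real n + 1) powr (2 * q)" for n
  proof -
    have "power_variation b q n (Y \<omega>) 1 = (\<Sum>k<b ^ n. \<bar>gincr b (Y \<omega>) n k\<bar> powr q)"
      by (rule power_variation_eq) simp
    also have "\<dots> \<le> (\<Sum>k<b ^ n. (C * (real n + 1)\<^sup>2 * (\<beta> powr (- R)) ^ n) powr q)"
      using q incr by (intro sum_mono powr_mono2) auto
    also have "\<dots> = \<beta> ^ n * (C * (real n + 1)\<^sup>2 * (\<beta> powr (- R)) ^ n) powr q"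
      by simp
    also have "\<dots> = C powr q * (\<beta> ^ n * ((\<beta> powr (- R)) ^ n) powr q) * ((real n + 1)\<^sup>2) powr q"
      using C by (simp add: powr_mult mult_ac)
    also have "\<beta> ^ n * ((\<beta> powr (- R)) ^ n) powr q = \<gamma> ^ n"
    proof -
      have "\<gamma> ^ n = \<beta> powr ((1 - q * R) * real n)"
        unfolding \<gamma>_def by (simp add: powr_power mult.commute)
      also have "\<dots> = \<beta> powr real n * (\<beta> powr (- R * real n)) powr q"
        unfolding powr_powr powr_add[symmetric] by (simp add: algebra_simps)
      finally show ?thesis by (simp add: powr_realpow powr_power mult.commute)
    qed
    also have "((real n + 1)\<^sup>2) powr q = (real n + 1) powr (2 * q)"
      by (simp add: powr_powr flip: powr_numeral)
    finally show ?thesis .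
  qed
  show ?thesis
  proof (rule tendsto_sandwich[of "\<lambda>_. 0"])
    show "(\<lambda>n. C powr q * \<gamma> ^ n * (real n + 1) powr (2 * q)) \<longlonglongrightarrow> 0"
      using \<gamma> by (rule exponential_beats_power_0)
    show "\<forall>\<^sub>F n in sequentially. 0 \<le> power_variation b q n (Y \<omega>) 1"
      by (intro always_eventually allI) (auto simp: power_variation_def intro!: sum_nonneg)
  qed (use bound in \<open>auto intro: always_eventually\<close>)
qed

section \<open>Combination of both bounds\<close>

lemma AE_admits_roughness_exponent:
  "AE \<omega> in M. admits_roughness_exponent b (Y \<omega>) (min H (min 1 (- log \<beta> \<alpha>)))"
proof -
  define K where "K = - log \<beta> \<alpha>"
  define R where "R = min H K"
  have K: "K > 0"
    using \<alpha>_pos \<alpha>_less_1 \<beta>_ge_2 by (simp add: K_def log_less_zero_cancel_iff)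
  have R: "min H (min 1 (- log \<beta> \<alpha>)) = R" "0 < R" "R \<le> 1" "R \<le> H" "R \<le> K"
    using H_pos H_less_1 K by (auto simp: R_def K_def)
  have \<alpha>K: "\<alpha> = \<beta> powr (- K)"
    using \<alpha>_pos \<beta>_ge_2 by (simp add: K_def)
  have lower: "AE \<omega> in M. \<forall>q>0. q * R < 1 \<longrightarrow>
     filterlim (\<lambda>n. power_variation b q n (Y \<omega>) 1) at_top sequentially"
  proof (cases "K < H")
    case False
    then show ?thesis using AE_power_variation_at_top_H by (simp add: R_def)
  next
    case True
    have "\<xi> = \<beta> powr (- H - - K)"
      unfolding \<xi>_def powr_diff by (subst \<alpha>K) (rule refl)
    then have "\<xi> < 1"
      using \<beta>_ge_2 True by (simp add: powr_less_one)
    moreover have "\<beta> * \<alpha> powr q > 1 \<longleftrightarrow> q * R < 1" for q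
    proof -
      have "\<beta> * \<alpha> powr q = \<beta> powr 1 * \<beta> powr (- K * q)"
        using \<beta>_ge_2 unfolding \<alpha>K powr_powr by simp
      also have "\<dots> = \<beta> powr (1 - q * R)"
        unfolding powr_add[symmetric] using True by (simp add: R_def mult.commute)
      finally show ?thesis
        using \<beta>_ge_2 powr_less_cancel_iff[of \<beta> 0 "1 - q * R"] by simp
    qed
    ultimately show ?thesis using AE_power_variation_at_top_\<alpha> by simp
  qed
  from lower AE_W_0 AE_continuous AE_eventually_dW_le show ?thesis
  proof eventually_elim
    case (elim \<omega>)
    from dB_uniform_bound[OF elim(4)] obtain C where C: "C \<ge> 0"
      "\<And>m j. j < b ^ m \<Longrightarrow> \<bar>dB m j \<omega>\<bar> \<le> C * (real m + 1) * sd m" by blast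
    \<comment> \<open>R is positive, so the extended reciprocal is finite and the two conditions
      compare q * R with 1.\<close>
    have inv: "1 / ereal R = ereal (1 / R)"
      using R by (simp add: one_ereal_def)
    show ?case
      unfolding admits_roughness_exponent_def R(1) inv less_ereal.simps
    proof (intro conjI allI impI)
      show "continuous_on {0..1} (Y \<omega>)"
        by (rule continuous_Y) (rule elim)+
      show "R \<in> {0..1}" using R by simp
    next
      fix q :: real assume "q > 0" "q < 1 / R"
      then show "filterlim (\<lambda>n. power_variation b q n (Y \<omega>) 1) at_top sequentially"
        using elim(1) R by (simp add: field_simps)
    next
      fix q :: real assume "q > 0" "1 / R < q"
      then show "(\<lambda>n. power_variation b q n (Y \<omega>) 1) \<longlonglongrightarrow> 0"
        using R by (intro power_variation_tendsto_0[OF elim(2) C]) (auto simp: field_simps K_def)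
    qed
  qed
qed

end

theorem corollary2p5:
  fixes M :: "'a measure" and H \<alpha> \<tau> :: real and b :: nat
    and \<kappa> :: "real \<Rightarrow> real" and W :: "real \<Rightarrow> 'a \<Rightarrow> real"
  assumes "prob_space M"
    and "0 < H" "H < 1"
    and "0 < \<alpha>" "\<alpha> < 1"
    and "b \<ge> 2"
    and "fractional_brownian_motion M H W"
    and "\<kappa> \<in> {0..1} \<rightarrow> {0..1}" "\<kappa> 0 = 0" "\<kappa> 1 = 1"
    and "H < \<tau>" "\<tau> \<le> 1" "hoelder_continuous_on {0..1} \<tau> \<kappa>"
  defines "K \<equiv> min 1 (- log (real b) \<alpha>)"
  shows "AE \<omega> in M. admits_roughness_exponent b
           (\<lambda>t. wiener_weierstrass_bridge \<alpha> b \<kappa> W t \<omega>) (min H K)"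
proof -
  obtain C where C: "\<forall>s\<in>{0..1}. \<forall>t\<in>{0..1}. \<bar>\<kappa> s - \<kappa> t\<bar> \<le> C * \<bar>s - t\<bar> powr \<tau>"
    using assms(13) unfolding hoelder_continuous_on_def by blast
  \<comment> \<open>The Hoelder bound between the points 1 and 0 reads 1 \<le> C.\<close>
  have "0 \<le> C"
    using C[rule_format, of 1 0] assms(9,10) by simp
  interpret prob_space M by fact
  interpret weierstrass_bridge M H W \<alpha> \<tau> C b \<kappa>
    using assms C \<open>0 \<le> C\<close> by unfold_locales auto
  show ?thesis
    unfolding K_def by (rule AE_admits_roughness_exponent)
qed

end
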